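(* Let $\mathcal A$ be a finite abelian group and $F:\mathcal A^{\mathbb Z}\to\mathcal A^{\mathbb Z}$ an abelian cellular automaton. The following are equivalent: (i) $F$ is character-diffusive; (ii) $F$ randomizes the class of harmonically mixing measures; (iii) $F$ randomizes the class of nondegenerate Bernoulli measures; (iv) $F$ randomizes some strongly nonuniform Bernoulli measure. This equivalence holds for each of the following three readings of "character-diffusive" and "randomizes" (the same reading being used in all four items): (a) strong character-diffusivity and strong randomization; (b) character-diffusivity in density and randomization in density; (c) for any fixed $\mathbb U\subset\mathbb Z$: character-diffusivity for characters of support $\subset\mathbb U$, and randomization on cylinders of support $\subset\mathbb U$.
   Context: $(\mathcal A,+)$ is a finite abelian group; $\mathcal A^{\mathbb Z}$ has the product topology and componentwise group structure. An abelian cellular automaton is a continuous group endomorphism of $\mathcal A^{\mathbb Z}$ commuting with the shift $\sigma(x)=(x_{i+1})_i$. A character of $\mathcal A^{\mathbb Z}$ is a continuous homomorphism $\chi$ to the unit circle, written uniquely $\chi(x)=\prod_{k\in\mathbb Z}\chi_k(x_k)$ with $\chi_k$ characters of $\mathcal A$, all but finitely many trivial; $\mathrm{supp}(\chi)=\{k:\chi_k\ne\mathbf 1\}$, $\mathrm{rank}(\chi)=|\mathrm{supp}(\chi)|$. The lower density of $X\subseteq\mathbb N$ is $\liminf_n|\{i\in X:i\le n\}|/n$. $F$ strongly diffuses $\chi$ if $\mathrm{rank}(\chi\circ F^t)\to\infty$ as $t\to\infty$; it diffuses $\chi$ in density if this convergence holds along some increasing sequence of times of lower density $1$. $F$ is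 strongly character-diffusive (resp. character-diffusive in density) if it strongly diffuses (resp. diffuses in density) every nontrivial character; it is character-diffusive for characters of support $\subset\mathbb U$ if it strongly diffuses every nontrivial character whose support is contained in $\mathbb U$. For a Borel probability measure $\mu$, $F\mu(U)=\mu(F^{-1}U)$; $\lambda$ is the uniform Bernoulli measure. $F$ strongly randomizes $\mu$ if $F^t\mu\to\lambda$ weak-$*$; in density if $F^{\varphi(t)}\mu\to\lambda$ for some increasing sequence $(\varphi(t))_t$ of lower density $1$; on cylinders of support $\subset\mathbb U$ if $F^t\mu([u]_S)\to\lambda([u]_S)$ for every finite $S\subset\mathbb U$ and $u\in\mathcal A^S$, where $[u]_S=\{x:x|_S=u\}$. $F$ randomizes a class if it randomizes each of its members. $\widehat\mu[\chi]=\int\chi\,d\mu$. $\mu$ is harmonically mixing if for all $\varepsilon>0$ there is $R>0$ such that $\mathrm{rank}(\chi)>R$ implies $|\widehat\mu[\chi]|<\varepsilon$; it is strongly nonuniform if $\widehat\mu[\chi]\ne0$ for all characters $\chi$. A Bernoulli measure is $\bigotimes_{\mathbb Z}\beta$ with $\beta$ a probability measure on $\mathcal A$; it is nondegenerate if for every proper subgroup of $\mathcal A$, the support of $\beta$ meets at least two cosets of that subgroup. *)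

theory Defs
  imports "HOL-Probability.Probability" "HOL-Library.Function_Algebras"
begin

text \<open>
  A finite abelian group is a type of sort \<open>{finite, ab_group_add}\<close>, and a configuration is a
  function of type \<open>int \<Rightarrow> 'a\<close>.  The componentwise group structure on configurations is the
  instance of \<open>ab_group_add\<close> for functions provided by \<open>Function_Algebras\<close>.
\<close>

type_synonym 'a config = "int \<Rightarrow> 'a"

definition config_topology :: "'a config topology" where
  "config_topology = product_topology (\<lambda>_. discrete_topology UNIV) UNIV"

definition config_borel :: "'a config measure" where
  "config_borel = sigma UNIV {V. openin config_topology V}"

definition shift :: "'a config \<Rightarrow> 'a config" where
  "shift x = (\<lambda>i. x (i + 1))"

definition abelian_CA :: "('a::ab_group_add config \<Rightarrow> 'a config) \<Rightarrow> bool" where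
  "abelian_CA F \<longleftrightarrow>
     continuous_map config_topology config_topology F \<and>
     (\<forall>x y. F (x + y) = F x + F y) \<and>
     (\<forall>x. F (shift x) = shift (F x))"


subsection \<open>Characters\<close>

text \<open>
  The same notion is used for configurations (with \<^const>\<open>config_topology\<close>) and for the finite
  group itself (with the discrete topology).
\<close>

definition character :: "'g::ab_group_add topology \<Rightarrow> ('g \<Rightarrow> complex) \<Rightarrow> bool" where
  "character T \<psi> \<longleftrightarrow>
     continuous_map T euclidean \<psi> \<and> (\<forall>x. cmod (\<psi> x) = 1) \<and> (\<forall>x y. \<psi> (x + y) = \<psi> x * \<psi> y)"

abbreviation config_character :: "('a::ab_group_add config \<Rightarrow> complex) \<Rightarrow> bool" where
  "config_character \<equiv> character config_topology"

definition nontrivial :: "('g \<Rightarrow> complex) \<Rightarrow> bool" where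
  "nontrivial \<psi> \<longleftrightarrow> \<psi> \<noteq> (\<lambda>_. 1)"

definition is_factorization ::
    "('a::ab_group_add config \<Rightarrow> complex) \<Rightarrow> (int \<Rightarrow> 'a \<Rightarrow> complex) \<Rightarrow> bool" where
  "is_factorization \<psi> c \<longleftrightarrow>
     (\<forall>k. character (discrete_topology UNIV) (c k)) \<and>
     finite {k. nontrivial (c k)} \<and>
     (\<forall>x. \<psi> x = (\<Prod>k | nontrivial (c k). c k (x k)))"

text \<open>The description is proper for every character: see \<open>ex1_factorization\<close> below.\<close>

definition factor :: "('a::ab_group_add config \<Rightarrow> complex) \<Rightarrow> int \<Rightarrow> 'a \<Rightarrow> complex" where
  "factor \<psi> = (THE c. is_factorization \<psi> c)"

definition char_supp :: "('a::ab_group_add config \<Rightarrow> complex) \<Rightarrow> int set" where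
  "char_supp \<psi> = {k. nontrivial (factor \<psi> k)}"

definition char_rank :: "('a::ab_group_add config \<Rightarrow> complex) \<Rightarrow> nat" where
  "char_rank \<psi> = card (char_supp \<psi>)"


subsection \<open>Diffusivity\<close>

definition lower_density :: "nat set \<Rightarrow> ereal" where
  "lower_density X = liminf (\<lambda>n. ereal (real (card {i \<in> X. i \<le> n}) / real n))"

definition strongly_diffuses ::
    "('a::ab_group_add config \<Rightarrow> 'a config) \<Rightarrow> ('a config \<Rightarrow> complex) \<Rightarrow> bool" where
  "strongly_diffuses F \<psi> \<longleftrightarrow> filterlim (\<lambda>t. char_rank (\<psi> \<circ> F ^^ t)) at_top sequentially"

definition diffuses_in_density ::
    "('a::ab_group_add config \<Rightarrow> 'a config) \<Rightarrow> ('a config \<Rightarrow> complex) \<Rightarrow> bool" where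
  "diffuses_in_density F \<psi> \<longleftrightarrow>
     (\<exists>\<phi> :: nat \<Rightarrow> nat. strict_mono \<phi> \<and> lower_density (range \<phi>) = 1 \<and>
        filterlim (\<lambda>t. char_rank (\<psi> \<circ> F ^^ \<phi> t)) at_top sequentially)"

definition strongly_character_diffusive ::
    "('a::ab_group_add config \<Rightarrow> 'a config) \<Rightarrow> bool" where
  "strongly_character_diffusive F \<longleftrightarrow>
     (\<forall>\<psi>. config_character \<psi> \<and> nontrivial \<psi> \<longrightarrow> strongly_diffuses F \<psi>)"

definition character_diffusive_in_density ::
    "('a::ab_group_add config \<Rightarrow> 'a config) \<Rightarrow> bool" where
  "character_diffusive_in_density F \<longleftrightarrow>
     (\<forall>\<psi>. config_character \<psi> \<and> nontrivial \<psi> \<longrightarrow> diffuses_in_density F \<psi>)"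

definition character_diffusive_on ::
    "int set \<Rightarrow> ('a::ab_group_add config \<Rightarrow> 'a config) \<Rightarrow> bool" where
  "character_diffusive_on U F \<longleftrightarrow>
     (\<forall>\<psi>. config_character \<psi> \<and> nontrivial \<psi> \<and> char_supp \<psi> \<subseteq> U \<longrightarrow> strongly_diffuses F \<psi>)"


subsection \<open>Measures and randomization\<close>

definition borel_prob_measures :: "'a config measure set" where
  "borel_prob_measures = {\<mu>. prob_space \<mu> \<and> sets \<mu> = sets config_borel}"

definition bernoulli :: "'a pmf \<Rightarrow> 'a config measure" where
  "bernoulli \<beta> = (\<Pi>\<^sub>M _\<in>UNIV. measure_pmf \<beta>)"

definition uniform_bernoulli :: "'a::finite config measure" where
  "uniform_bernoulli = bernoulli (pmf_of_set UNIV)"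

abbreviation pushforward ::
    "('a config \<Rightarrow> 'a config) \<Rightarrow> 'a config measure \<Rightarrow> 'a config measure" where
  "pushforward F \<mu> \<equiv> distr \<mu> config_borel F"

text \<open>Continuous functions on the (compact) configuration space are automatically bounded.\<close>

definition weak_star_conv :: "(nat \<Rightarrow> 'a config measure) \<Rightarrow> 'a config measure \<Rightarrow> bool" where
  "weak_star_conv M N \<longleftrightarrow>
     (\<forall>f :: 'a config \<Rightarrow> real. continuous_map config_topology euclidean f \<longrightarrow>
        (\<lambda>t. \<integral>x. f x \<partial>M t) \<longlonglongrightarrow> (\<integral>x. f x \<partial>N))"

text \<open>Only the values of \<open>u\<close> on \<open>S\<close> matter, so patterns on \<open>S\<close> are given as total functions.\<close>

definition cylinder :: "int set \<Rightarrow> (int \<Rightarrow> 'a) \<Rightarrow> 'a config set" where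
  "cylinder S u = {x. \<forall>i\<in>S. x i = u i}"

definition strongly_randomizes ::
    "('a::finite config \<Rightarrow> 'a config) \<Rightarrow> 'a config measure \<Rightarrow> bool" where
  "strongly_randomizes F \<mu> \<longleftrightarrow> weak_star_conv (\<lambda>t. pushforward (F ^^ t) \<mu>) uniform_bernoulli"

definition randomizes_in_density ::
    "('a::finite config \<Rightarrow> 'a config) \<Rightarrow> 'a config measure \<Rightarrow> bool" where
  "randomizes_in_density F \<mu> \<longleftrightarrow>
     (\<exists>\<phi> :: nat \<Rightarrow> nat. strict_mono \<phi> \<and> lower_density (range \<phi>) = 1 \<and>
        weak_star_conv (\<lambda>t. pushforward (F ^^ \<phi> t) \<mu>) uniform_bernoulli)"

definition randomizes_on_cylinders ::
    "int set \<Rightarrow> ('a::finite config \<Rightarrow> 'a config) \<Rightarrow> 'a config measure \<Rightarrow> bool" where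
  "randomizes_on_cylinders U F \<mu> \<longleftrightarrow>
     (\<forall>S u. finite S \<and> S \<subseteq> U \<longrightarrow>
        (\<lambda>t. measure (pushforward (F ^^ t) \<mu>) (cylinder S u))
          \<longlonglongrightarrow> measure uniform_bernoulli (cylinder S u))"


subsection \<open>Classes of measures\<close>

definition fourier_coeff :: "'a config measure \<Rightarrow> ('a config \<Rightarrow> complex) \<Rightarrow> complex" where
  "fourier_coeff \<mu> \<psi> = (\<integral>x. \<psi> x \<partial>\<mu>)"

definition harmonically_mixing :: "'a::ab_group_add config measure \<Rightarrow> bool" where
  "harmonically_mixing \<mu> \<longleftrightarrow>
     (\<forall>\<epsilon>>0. \<exists>R>0. \<forall>\<psi>. config_character \<psi> \<and> char_rank \<psi> > R \<longrightarrow> cmod (fourier_coeff \<mu> \<psi>) < \<epsilon>)"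

definition strongly_nonuniform :: "'a::ab_group_add config measure \<Rightarrow> bool" where
  "strongly_nonuniform \<mu> \<longleftrightarrow> (\<forall>\<psi>. config_character \<psi> \<longrightarrow> fourier_coeff \<mu> \<psi> \<noteq> 0)"

definition is_subgroup :: "'a::ab_group_add set \<Rightarrow> bool" where
  "is_subgroup H \<longleftrightarrow> 0 \<in> H \<and> (\<forall>x\<in>H. \<forall>y\<in>H. x + y \<in> H) \<and> (\<forall>x\<in>H. - x \<in> H)"

definition cosets :: "'a::ab_group_add set \<Rightarrow> 'a set set" where
  "cosets H = {(+) a ` H | a. True}"

definition nondegenerate :: "'a::ab_group_add pmf \<Rightarrow> bool" where
  "nondegenerate \<beta> \<longleftrightarrow>
     (\<forall>H. is_subgroup H \<and> H \<noteq> UNIV \<longrightarrow>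
        (\<exists>C\<in>cosets H. \<exists>D\<in>cosets H. C \<noteq> D \<and> set_pmf \<beta> \<inter> C \<noteq> {} \<and> set_pmf \<beta> \<inter> D \<noteq> {}))"

definition harmonically_mixing_measures :: "'a::ab_group_add config measure set" where
  "harmonically_mixing_measures = {\<mu> \<in> borel_prob_measures. harmonically_mixing \<mu>}"

definition nondegenerate_bernoulli_measures :: "'a::ab_group_add config measure set" where
  "nondegenerate_bernoulli_measures = {bernoulli \<beta> | \<beta>. nondegenerate \<beta>}"

definition strongly_nonuniform_bernoulli_measures :: "'a::ab_group_add config measure set" where
  "strongly_nonuniform_bernoulli_measures =
     {bernoulli \<beta> | \<beta>. strongly_nonuniform (bernoulli \<beta>)}"


subsection \<open>Well-definedness\<close>

lemma openin_config_topology: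
  "openin config_topology W \<longleftrightarrow>
     (\<forall>x\<in>W. \<exists>V. finite {i. V i \<noteq> UNIV} \<and> (\<forall>i. x i \<in> V i) \<and> (\<forall>y. (\<forall>i. y i \<in> V i) \<longrightarrow> y \<in> W))"
  by (simp add: config_topology_def openin_product_topology_alt PiE_UNIV_domain Pi_iff subset_iff)

lemma character_0: "character T \<psi> \<Longrightarrow> \<psi> 0 = 1"
proof -
  assume c: "character T \<psi>"
  then have "\<psi> (0 + 0) = \<psi> 0 * \<psi> 0" "cmod (\<psi> 0) = 1"
    unfolding character_def by blast+
  then show ?thesis by auto
qed

lemma is_factorization_single:
  assumes "is_factorization \<psi> c"
  shows "c k a = \<psi> (\<lambda>i. if i = k then a else 0)"
proof -
  let ?N = "{k. nontrivial (c k)}"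
  have c0: "c j 0 = 1" for j
    using assms character_0 unfolding is_factorization_def by blast
  have fin: "finite ?N" using assms unfolding is_factorization_def by blast
  have "\<psi> (\<lambda>i. if i = k then a else 0) = (\<Prod>j\<in>?N. c j (if j = k then a else 0))"
    using assms unfolding is_factorization_def by blast
  also have "\<dots> = (\<Prod>j\<in>?N. if j = k then c k a else 1)"
    by (intro prod.cong) (auto simp: c0)
  also have "\<dots> = (if k \<in> ?N then c k a else 1)"
    using fin by (simp add: prod.delta')
  also have "\<dots> = c k a" by (auto simp: nontrivial_def)
  finally show ?thesis by simp
qed

lemma unit_powers_near_1:
  fixes z :: complex
  assumes "cmod z = 1" and near: "\<And>n. Re (z ^ n) \<ge> 1/2"
  shows "z = 1"
proof (rule ccontr)
  assume z: "z \<noteq> 1"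
  then have pos: "cmod (z - 1) > 0" by simp
  obtain n :: nat where n: "real n > 4 / cmod (z - 1)"
    using reals_Archimedean2 by blast
  have "real n / 2 \<le> (\<Sum>i<n. Re (z ^ i))"
    using sum_mono[of "{..<n}" "\<lambda>_. 1/2" "\<lambda>i. Re (z ^ i)"] near by simp
  also have "\<dots> = Re (\<Sum>i<n. z ^ i)" by simp
  also have "\<dots> \<le> cmod (\<Sum>i<n. z ^ i)" by (rule complex_Re_le_cmod)
  also have "\<dots> = cmod (z ^ n - 1) / cmod (z - 1)"
    using z by (simp add: geometric_sum norm_divide)
  also have "\<dots> \<le> 2 / cmod (z - 1)"
    using norm_triangle_ineq4[of "z ^ n" 1] assms(1)
    by (intro divide_right_mono) (auto simp: norm_power)
  finally show False using n by simp
qed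

lemma ex_factorization:
  fixes \<psi> :: "'a::ab_group_add config \<Rightarrow> complex"
  assumes chi: "config_character \<psi>"
  shows "\<exists>c. is_factorization \<psi> c"
proof -
  define single :: "int \<Rightarrow> 'a \<Rightarrow> 'a config" where "single k a = (\<lambda>i. if i = k then a else 0)" for k a
  define c where "c k a = \<psi> (single k a)" for k a
  have cont: "continuous_map config_topology euclidean \<psi>"
    and unit: "cmod (\<psi> x) = 1" and mult: "\<psi> (x + y) = \<psi> x * \<psi> y" for x y
    using chi unfolding character_def by blast+
  have chi0: "\<psi> 0 = 1" using chi by (rule character_0)
  have top: "topspace (config_topology :: 'a config topology) = UNIV"
    by (simp add: config_topology_def)
  let ?W = "{x. \<psi> x \<in> ball 1 (1/2)}"
  have W: "openin config_topology ?W"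
    using openin_continuous_map_preimage[OF cont, of "ball 1 (1/2)"] by (simp add: top)
  have "0 \<in> ?W" by (simp add: chi0)
  from bspec[OF W[unfolded openin_config_topology] this]
  obtain V where "finite {i. V i \<noteq> UNIV} \<and> (\<forall>i. (0 :: 'a config) i \<in> V i) \<and>
      (\<forall>y. (\<forall>i. y i \<in> V i) \<longrightarrow> y \<in> ?W)" ..
  then have V: "finite {i. V i \<noteq> UNIV}" "\<And>i. 0 \<in> V i" "\<And>y. (\<And>i. y i \<in> V i) \<Longrightarrow> y \<in> ?W"
    by simp_all
  define S where "S = {i. V i \<noteq> UNIV}"
  have off: "\<psi> x = 1" if x: "\<And>i. i \<in> S \<Longrightarrow> x i = 0" for x
  proof (rule unit_powers_near_1[OF unit])
    fix n
    have "\<exists>y. (\<forall>i\<in>S. y i = 0) \<and> \<psi> y = \<psi> x ^ n"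
    proof (induction n)
      case 0
      show ?case using chi0 by (intro exI[of _ 0]) (simp add: zero_fun_def)
    next
      case (Suc n)
      then obtain y where "\<forall>i\<in>S. y i = 0" "\<psi> y = \<psi> x ^ n" by blast
      then show ?case using x mult[of x y] by (intro exI[of _ "x + y"]) (simp add: plus_fun_def)
    qed
    then obtain y where y: "\<forall>i\<in>S. y i = 0" "\<psi> y = \<psi> x ^ n" by blast
    have "y i \<in> V i" for i
    proof (cases "i \<in> S")
      case True
      then show ?thesis using y(1) V(2) by simp
    next
      case False
      then show ?thesis by (simp add: S_def)
    qed
    then have "\<psi> x ^ n \<in> ball 1 (1/2)" using V(3)[of y] y(2) by simp
    then have "cmod (1 - \<psi> x ^ n) < 1/2" by (simp add: dist_norm)
    then show "Re (\<psi> x ^ n) \<ge> 1/2"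
      using complex_Re_le_cmod[of "1 - \<psi> x ^ n"] by simp
  qed
  have on: "\<psi> (\<lambda>i. if i \<in> T then x i else 0) = (\<Prod>k\<in>T. c k (x k))" if "finite T" for T x
    using that
  proof (induction T rule: finite_induct)
    case empty
    then show ?case using chi0 by (simp add: zero_fun_def)
  next
    case (insert k T)
    have "(\<lambda>i. if i \<in> insert k T then x i else 0) =
        single k (x k) + (\<lambda>i. if i \<in> T then x i else 0)"
      using insert.hyps by (auto simp: single_def fun_eq_iff)
    then show ?case using insert by (simp add: mult c_def)
  qed
  have finS: "finite S" using V(1) by (simp add: S_def)
  have sub: "{k. nontrivial (c k)} \<subseteq> S"
  proof
    fix k assume "k \<in> {k. nontrivial (c k)}"
    then obtain a where "\<psi> (single k a) \<noteq> 1" by (auto simp: nontrivial_def c_def fun_eq_iff)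
    then show "k \<in> S" using off[of "single k a"] unfolding single_def by metis
  qed
  have "is_factorization \<psi> c"
    unfolding is_factorization_def
  proof (intro conjI allI)
    fix k
    have "single k (a + b) = single k a + single k b" for a b
      by (auto simp: single_def fun_eq_iff)
    then show "character (discrete_topology UNIV) (c k)"
      by (simp add: character_def c_def unit mult)
  next
    show "finite {k. nontrivial (c k)}" using sub finS by (rule finite_subset)
  next
    fix x :: "'a config"
    let ?x1 = "\<lambda>i. if i \<in> S then x i else 0 :: 'a" and ?x2 = "\<lambda>i. if i \<in> S then 0 :: 'a else x i"
    have "x = ?x1 + ?x2" by (auto simp: fun_eq_iff)
    then have "\<psi> x = \<psi> ?x1 * \<psi> ?x2" using mult by metis
    also have "\<dots> = (\<Prod>k\<in>S. c k (x k))" using off[of ?x2] on[OF finS] by simp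
    also have "\<dots> = (\<Prod>k | nontrivial (c k). c k (x k))"
      using sub by (intro prod.mono_neutral_right finS) (auto simp: nontrivial_def)
    finally show "\<psi> x = (\<Prod>k | nontrivial (c k). c k (x k))" .
  qed
  then show ?thesis by (intro exI[of _ c])
qed

lemma ex1_factorization:
  fixes \<psi> :: "'a::ab_group_add config \<Rightarrow> complex"
  assumes "config_character \<psi>"
  shows "\<exists>!c. is_factorization \<psi> c"
proof (rule ex_ex1I[OF ex_factorization[OF assms]])
  fix c d assume "is_factorization \<psi> c" "is_factorization \<psi> d"
  then show "c = d" by (intro ext) (simp add: is_factorization_single)
qed

lemma sets_bernoulli: "sets (bernoulli \<beta>) = sets (config_borel :: 'a::finite config measure)"
proof -
  let ?P = "\<Pi>\<^sub>M _\<in>(UNIV :: int set). count_space (UNIV :: 'a set)"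
  let ?O = "{V. openin (config_topology :: 'a config topology) V}"
  have eq: "sets (bernoulli \<beta>) = sets ?P"
    unfolding bernoulli_def by (intro sets_PiM_cong) auto
  have spP: "space ?P = UNIV" by (simp add: space_PiM)
  have borel: "sets (config_borel :: 'a config measure) = sigma_sets UNIV ?O"
    unfolding config_borel_def by (rule sets_measure_of) simp
  have cyl: "cylinder S u \<in> sets ?P" if "finite S" for S and u :: "int \<Rightarrow> 'a"
  proof -
    have "cylinder S u = (\<Pi>\<^sub>E i\<in>UNIV. if i \<in> S then {u i} else UNIV)"
      by (auto simp: cylinder_def PiE_iff split: if_splits)
    then show ?thesis by (auto intro!: sets_PiM_I_countable)
  qed
  have "?O \<subseteq> sets ?P"
  proof
    fix V assume "V \<in> ?O"
    then have V: "openin config_topology V" by simp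
    define pat :: "'a config \<Rightarrow> (int \<times> 'a) set \<Rightarrow> bool"
      where "pat x p \<longleftrightarrow> (\<forall>(i, a)\<in>p. x i = a)" for x p
    define K where "K = {p. finite p \<and> {x. pat x p} \<subseteq> V}"
    have "countable K"
      by (rule countable_subset[OF _ countable_Collect_finite]) (auto simp: K_def)
    have meas: "{x. pat x p} \<in> sets ?P" if p: "finite p" for p
    proof -
      have "{x. pat x p} = (\<Inter>(i, a)\<in>p. cylinder {i} (\<lambda>_. a)) \<inter> space ?P"
        by (auto simp: pat_def cylinder_def spP)
      also have "\<dots> \<in> sets ?P"
      proof (cases "p = {}")
        case True
        then show ?thesis by simp
      next
        case False
        then show ?thesis using p cyl
          by (intro sets.Int sets.finite_INT) auto
      qed
      finally show ?thesis .
    qed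
    have "V = (\<Union>p\<in>K. {x. pat x p})"
    proof
      show "V \<subseteq> (\<Union>p\<in>K. {x. pat x p})"
      proof
        fix x assume "x \<in> V"
        then obtain W where W: "finite {i. W i \<noteq> UNIV}" "\<forall>i. x i \<in> W i"
            "\<forall>y. (\<forall>i. y i \<in> W i) \<longrightarrow> y \<in> V"
          using V unfolding openin_config_topology by blast
        define p where "p = (\<lambda>i. (i, x i)) ` {i. W i \<noteq> UNIV}"
        have "y \<in> V" if "pat y p" for y
        proof -
          have "y i \<in> W i" for i
          proof (cases "W i = UNIV")
            case False
            then have "y i = x i" using that by (auto simp: pat_def p_def)
            then show ?thesis using W(2) by simp
          qed simp
          then show ?thesis using W(3) by simp
        qed
        then have "p \<in> K" using W(1) by (auto simp: K_def p_def)
        moreover have "pat x p" by (auto simp: pat_def p_def)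
        ultimately show "x \<in> (\<Union>p\<in>K. {x. pat x p})" by blast
      qed
    qed (auto simp: K_def)
    also have "\<dots> \<in> sets ?P"
      using \<open>countable K\<close> meas by (intro sets.countable_UN') (auto simp: K_def)
    finally show "V \<in> sets ?P" .
  qed
  then have "sigma_sets UNIV ?O \<subseteq> sets ?P"
    using sets.sigma_sets_subset[of ?O ?P] spP by simp
  moreover have "sets ?P \<subseteq> sets (config_borel :: 'a config measure)"
  proof (rule sets_PiM_in_sets)
    show "space (config_borel :: 'a config measure) = (\<Pi>\<^sub>E i\<in>UNIV. space (count_space UNIV))"
      by (simp add: config_borel_def space_measure_of_conv)
  next
    fix i :: int and A :: "'a set"
    have "openin config_topology {x. x i \<in> A}"
      unfolding openin_config_topology
    proof
      fix x assume "x \<in> {x. x i \<in> A}"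
      moreover have "finite {j. (if j = i then A else UNIV) \<noteq> UNIV}"
        by (rule finite_subset[of _ "{i}"]) auto
      ultimately show "\<exists>V. finite {j. V j \<noteq> UNIV} \<and> (\<forall>j. x j \<in> V j) \<and>
          (\<forall>y. (\<forall>j. y j \<in> V j) \<longrightarrow> y \<in> {x. x i \<in> A})"
        by (intro exI[of _ "\<lambda>j. if j = i then A else UNIV"]) (auto split: if_splits)
    qed
    moreover have "space (config_borel :: 'a config measure) = UNIV"
      by (simp add: config_borel_def space_measure_of_conv)
    ultimately show "{x \<in> space (config_borel :: 'a config measure). x i \<in> A} \<in> sets config_borel"
      unfolding borel by (auto intro: sigma_sets.Basic)
  qed
  ultimately show ?thesis using eq borel by auto
qed

lemma bernoulli_in_borel_prob_measures:
  "bernoulli \<beta> \<in> (borel_prob_measures :: 'a::finite config measure set)"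
proof -
  have "prob_space (bernoulli \<beta>)"
    unfolding bernoulli_def by (rule prob_space_PiM) (rule measure_pmf.prob_space_axioms)
  then show ?thesis
    unfolding borel_prob_measures_def using sets_bernoulli by blast
qed

lemma continuous_map_config_measurable:
  assumes "continuous_map config_topology config_topology F"
  shows "F \<in> config_borel \<rightarrow>\<^sub>M config_borel"
proof -
  have sp: "space config_borel = UNIV"
    by (simp add: config_borel_def space_measure_of_conv)
  have st: "sets config_borel = sigma_sets UNIV {V. openin config_topology V}"
    unfolding config_borel_def by (rule sets_measure_of) simp
  have top: "topspace config_topology = UNIV" by (simp add: config_topology_def)
  show ?thesis
    unfolding config_borel_def[where 'a='b]
  proof (rule measurable_measure_of)
    fix V :: "'b config set" assume "V \<in> {V. openin config_topology V}"
    then have "openin config_topology {x. F x \<in> V}"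
      using openin_continuous_map_preimage[OF assms, of V] by (simp add: top)
    moreover have "F -` V \<inter> space config_borel = {x. F x \<in> V}" by (auto simp: sp)
    ultimately show "F -` V \<inter> space config_borel \<in> sets config_borel"
      unfolding st by (auto intro: sigma_sets.Basic)
  qed (auto simp: sp)
qed

end

theory Submission
  imports Defs
begin

text \<open>
  Write \<open>\<mu>^\<close> for the Fourier transform of a measure \<open>\<mu>\<close>.  Then \<open>(F\<^sup>t \<mu>)^[\<psi>] = \<mu>^[\<psi> \<circ> F\<^sup>t]\<close>, and
  indicators of cylinders and characters are finite linear combinations of each other, so
  randomization means that \<open>\<mu>^[\<psi> \<circ> F\<^sup>t]\<close> tends to \<open>0\<close> for every nontrivial \<open>\<psi>\<close>.  For harmonically
  mixing measures this follows when the ranks tend to infinity.  Bernoulli measures satisfy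
  \<open>m ^ rank \<psi> \<le> \<bar>\<mu>^[\<psi>]\<bar> \<le> q ^ rank \<psi>\<close>, where \<open>q < 1\<close> if the measure is nondegenerate and \<open>m > 0\<close> if it is
  strongly nonuniform; the second bound gives harmonic mixing, the first one makes the ranks
  tend to infinity whenever the coefficients vanish in the limit.  In the density reading, the
  sequences of times of the countably many characters are merged by a diagonal argument.
\<close>

subsection \<open>Characters of a finite abelian group\<close>

text \<open>Writing a cylinder indicator through characters requires that the characters of the
  finite group separate its points. This is proved by extension: a character of a subgroup extends
  to one further generator once a compatible root on the unit circle is chosen, and a domain of
  maximal size must be the whole group. Finiteness of the dual also makes the two rank bounds
  uniform: \<open>q\<close> is a maximum and \<open>m\<close> a minimum over the finitely many mean
  values of characters under one coordinate's distribution. Passing from "all nondegenerate" to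
  "some strongly nonuniform" needs a Bernoulli measure of both kinds; half a point mass at 0 plus
  half the uniform distribution is one. In the density reading only one direction is delicate. A
  randomizing sequence serves all characters at once, whereas diffusion gives each character its own
  sequence, and infinitely many sets of density 1 may have empty intersection. The diagonal set is
  contained in each of them only up to finitely many times, which is harmless for ranks tending to
  infinity.\<close>

definition nat_mult :: "nat \<Rightarrow> 'a::ab_group_add \<Rightarrow> 'a" where
  "nat_mult n x = (\<Sum>i<n. x)"

lemma nat_mult_0 [simp]: "nat_mult 0 x = 0"
  by (simp add: nat_mult_def)

lemma nat_mult_Suc [simp]: "nat_mult (Suc n) x = nat_mult n x + x"
  by (simp add: nat_mult_def)

lemma nat_mult_add: "nat_mult (m + n) x = nat_mult m x + nat_mult n x"
  by (induction n) (simp_all add: add.assoc)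

lemma nat_mult_mult: "nat_mult (m * n) x = nat_mult m (nat_mult n x)"
  by (induction m) (simp_all add: nat_mult_add add.commute)

text \<open>Pigeonhole: two of the infinitely many multiples coincide, and the difference of their
  indices is a period.\<close>

lemma nat_mult_period:
  fixes x :: "'a::{finite, ab_group_add}"
  shows "\<exists>n>0. nat_mult n x = 0"
proof -
  have "\<not> inj (\<lambda>n. nat_mult n x)"
    using finite_imageD[of "\<lambda>n. nat_mult n x" UNIV] by auto
  then obtain m n where "m < n" "nat_mult m x = nat_mult n x"
    by (metis injI linorder_neqE_nat)
  then show ?thesis
    using nat_mult_add[of m "n - m" x] by (intro exI[of _ "n - m"]) auto
qed

text \<open>Closure of \<open>H\<close> under negation is not demanded: in a finite group it is automatic.\<close>

definition partial_character :: "'a::ab_group_add set \<Rightarrow> ('a \<Rightarrow> complex) \<Rightarrow> bool" where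
  "partial_character H \<psi> \<longleftrightarrow>
     0 \<in> H \<and> (\<forall>x\<in>H. \<forall>y\<in>H. x + y \<in> H \<and> \<psi> (x + y) = \<psi> x * \<psi> y) \<and> (\<forall>x\<in>H. cmod (\<psi> x) = 1)"

lemma partial_character_0:
  assumes "partial_character H \<psi>"
  shows "\<psi> 0 = 1"
proof -
  have "\<psi> (0 + 0) = \<psi> 0 * \<psi> 0" "cmod (\<psi> 0) = 1"
    using assms unfolding partial_character_def by blast+
  then show ?thesis by auto
qed

lemma partial_character_nat_mult:
  assumes "partial_character H \<psi>" "x \<in> H"
  shows "nat_mult n x \<in> H" "\<psi> (nat_mult n x) = \<psi> x ^ n"
proof -
  have "nat_mult n x \<in> H \<and> \<psi> (nat_mult n x) = \<psi> x ^ n"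
    using assms partial_character_0[OF assms(1)]
    by (induction n) (auto simp: partial_character_def)
  then show "nat_mult n x \<in> H" "\<psi> (nat_mult n x) = \<psi> x ^ n" by auto
qed

text \<open>If \<open>n\<close> is a period of \<open>x\<close>, then the inverse of
  \<open>x\<close> is its multiple by \<open>n - 1\<close>, so closure under addition is
  enough.\<close>

lemma partial_character_uminus:
  fixes x :: "'a::{finite, ab_group_add}"
  assumes "partial_character H \<psi>" "x \<in> H"
  shows "- x \<in> H"
proof -
  obtain n where n: "n > 0" "nat_mult n x = 0" using nat_mult_period by blast
  then have "nat_mult (n - 1) x + x = 0" by (cases n) auto
  then have "- x = nat_mult (n - 1) x" by (metis add_eq_0_iff2 minus_minus)
  then show ?thesis using partial_character_nat_mult[OF assms] by metis
qed

text \<open>The new domain consists of all \<open>h + nat_mult k g\<close> with \<open>h\<close> in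
  \<open>H\<close>, and the value there is \<open>\<psi> h * w ^ k\<close>. The only danger is that
  an element has two such forms. Since \<open>n\<close> is the first positive index whose multiple
  of \<open>g\<close> falls into \<open>H\<close>, all such indices are multiples of
  \<open>n\<close>, and the equation for \<open>w ^ n\<close> makes the two prescriptions
  agree.\<close>

lemma partial_character_extend:
  fixes g :: "'a::{finite, ab_group_add}"
  assumes \<psi>: "partial_character H \<psi>"
    and n: "n > 0" "nat_mult n g \<in> H" "\<And>m. 0 < m \<Longrightarrow> m < n \<Longrightarrow> nat_mult m g \<notin> H"
    and w: "cmod w = 1" "w ^ n = \<psi> (nat_mult n g)"
  shows "\<exists>K \<phi>. partial_character K \<phi> \<and> H \<subseteq> K \<and> g \<in> K \<and> (\<forall>x\<in>H. \<phi> x = \<psi> x) \<and> \<phi> g = w"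
proof -
  have add: "x + y \<in> H" "\<psi> (x + y) = \<psi> x * \<psi> y" if "x \<in> H" "y \<in> H" for x y
    using \<psi> that unfolding partial_character_def by blast+
  have zero: "0 \<in> H" and unit: "x \<in> H \<Longrightarrow> cmod (\<psi> x) = 1" for x
    using \<psi> unfolding partial_character_def by blast+
  have diff: "x - y \<in> H" if "x \<in> H" "y \<in> H" for x y
    using add(1)[OF that(1) partial_character_uminus[OF \<psi> that(2)]] by simp
  \<comment> \<open>Divide \<open>k\<close> by \<open>n\<close> with remainder: the multiple of
    \<open>g\<close> by the remainder is a difference of elements of \<open>H\<close>, so minimality
    of \<open>n\<close> forces the remainder to be 0.\<close>
  have compat: "\<psi> (nat_mult k g) = w ^ k" if k: "nat_mult k g \<in> H" for k
  proof -
    have eq: "nat_mult k g = nat_mult (k div n) (nat_mult n g) + nat_mult (k mod n) g"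
      by (metis nat_mult_add nat_mult_mult div_mult_mod_eq)
    then have "nat_mult (k mod n) g = nat_mult k g - nat_mult (k div n) (nat_mult n g)"
      by simp
    then have "nat_mult (k mod n) g \<in> H"
      using diff[OF k partial_character_nat_mult(1)[OF \<psi> n(2)]] by metis
    then have "k mod n = 0"
      using n(3)[of "k mod n"] mod_less_divisor[OF n(1), of k] by blast
    then have k_eq: "k = n * (k div n)" and "nat_mult k g = nat_mult (k div n) (nat_mult n g)"
      using eq by auto
    then have "\<psi> (nat_mult k g) = (w ^ n) ^ (k div n)"
      using partial_character_nat_mult(2)[OF \<psi> n(2)] w(2) by metis
    then show ?thesis using k_eq by (metis power_mult)
  qed
  \<comment> \<open>A pair is one way of writing \<open>y\<close> as an element of \<open>H\<close>
    plus a multiple of \<open>g\<close>; \<open>\<phi>\<close> evaluates an arbitrary such pair, and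
    \<open>wd\<close> shows that the choice is immaterial.\<close>
  define rep where "rep y p \<longleftrightarrow> fst p \<in> H \<and> y = fst p + nat_mult (snd p) g" for y and p :: "'a \<times> nat"
  define K where "K = {y. \<exists>p. rep y p}"
  define \<phi> where "\<phi> y = (let p = SOME p. rep y p in \<psi> (fst p) * w ^ snd p)" for y
  \<comment> \<open>Ordering the two exponents keeps the subtraction of natural numbers exact;
    \<open>wd\<close> covers the other order by exchanging the pairs.\<close>
  have wd_le: "\<psi> h * w ^ k = \<psi> h' * w ^ k'"
    if "h \<in> H" "h' \<in> H" "h + nat_mult k g = h' + nat_mult k' g" "k \<le> k'" for h h' k k'
  proof -
    have "nat_mult k' g = nat_mult k g + nat_mult (k' - k) g"
      using nat_mult_add[of k "k' - k" g] that(4) by simp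
    then have h: "h = h' + nat_mult (k' - k) g"
      using that(3) by (simp add: algebra_simps)
    then have "nat_mult (k' - k) g = h - h'" by simp
    then have "nat_mult (k' - k) g \<in> H" using diff[OF that(1,2)] by simp
    then have "\<psi> h = \<psi> h' * w ^ (k' - k)" using h add(2)[OF that(2)] compat by metis
    then show ?thesis using that(4) by (simp flip: power_add)
  qed
  have wd: "\<phi> (h + nat_mult k g) = \<psi> h * w ^ k" if h: "h \<in> H" for h k
  proof -
    let ?p = "SOME p. rep (h + nat_mult k g) p"
    have "rep (h + nat_mult k g) (h, k)" using h by (simp add: rep_def)
    then have "rep (h + nat_mult k g) ?p" by (rule someI)
    then have "fst ?p \<in> H" "h + nat_mult k g = fst ?p + nat_mult (snd ?p) g"
      unfolding rep_def by auto
    then have "\<psi> (fst ?p) * w ^ snd ?p = \<psi> h * w ^ k"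
      using wd_le[of h "fst ?p" k "snd ?p"] wd_le[of "fst ?p" h "snd ?p" k] h
      by (metis nle_le)
    then show ?thesis by (simp add: \<phi>_def)
  qed
  have K: "y \<in> K \<longleftrightarrow> (\<exists>h\<in>H. \<exists>k. y = h + nat_mult k g)" for y
    by (auto simp: K_def rep_def)
  have "partial_character K \<phi>"
    unfolding partial_character_def
  proof (intro conjI ballI)
    show "0 \<in> K" unfolding K using zero by (intro bexI[of _ 0] exI[of _ 0]) auto
  next
    fix x y assume "x \<in> K" "y \<in> K"
    then obtain h k h' k' where hk: "h \<in> H" "x = h + nat_mult k g" "h' \<in> H" "y = h' + nat_mult k' g"
      unfolding K by blast
    then have eq: "x + y = (h + h') + nat_mult (k + k') g"
      by (simp add: nat_mult_add algebra_simps)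
    show "x + y \<in> K" unfolding K using eq add(1)[of h h'] hk by blast
    have "\<phi> (x + y) = \<psi> (h + h') * w ^ (k + k')"
      unfolding eq using add(1)[of h h'] hk by (intro wd) auto
    also have "\<dots> = \<phi> x * \<phi> y"
      using hk add(2) by (simp add: wd power_add)
    finally show "\<phi> (x + y) = \<phi> x * \<phi> y" .
  next
    fix x assume "x \<in> K"
    then obtain h k where "h \<in> H" "x = h + nat_mult k g" unfolding K by blast
    then show "cmod (\<phi> x) = 1" by (simp add: wd norm_mult norm_power unit w(1))
  qed
  moreover have "\<phi> x = \<psi> x" "x \<in> K" if "x \<in> H" for x
    using wd[OF that, of 0] that K by (auto intro!: bexI[of _ x] exI[of _ 0])
  moreover have "\<phi> g = w" "g \<in> K"
    using wd[OF zero, of 1] partial_character_0[OF \<psi>] K zero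
    by (auto intro!: bexI[of _ 0] exI[of _ 1])
  ultimately show ?thesis by blast
qed

lemma ex_least_nat_mult_in:
  fixes g :: "'a::{finite, ab_group_add}"
  assumes "0 \<in> H"
  obtains n where "n > 0" "nat_mult n g \<in> H" "\<And>m. 0 < m \<Longrightarrow> m < n \<Longrightarrow> nat_mult m g \<notin> H"
proof -
  obtain n where "n > 0 \<and> nat_mult n g \<in> H" using nat_mult_period assms by metis
  from LeastI[of "\<lambda>n. n > 0 \<and> nat_mult n g \<in> H", OF this] not_less_Least[of _ "\<lambda>n. n > 0 \<and> nat_mult n g \<in> H"]
  show ?thesis using that by blast
qed

lemma ex_unit_root:
  assumes "cmod z = 1" "n > 0"
  obtains w where "cmod w = 1" "w ^ n = z"
proof
  show "cmod (cis (Arg z / n)) = 1" by simp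
  have "cis (Arg z / n) ^ n = cis (Arg z)" using assms(2) by (subst Complex.DeMoivre) simp
  also have "\<dots> = z" using assms(1) cis_Arg[of z] by (cases "z = 0") (auto simp: sgn_eq)
  finally show "cis (Arg z / n) ^ n = z" .
qed

section \<open>The dual group: separation of points and orthogonality\<close>

definition dual :: "('a::ab_group_add \<Rightarrow> complex) set" where
  "dual = {\<psi>. character (discrete_topology UNIV) \<psi>}"

lemma dual_iff: "\<psi> \<in> dual \<longleftrightarrow> (\<forall>x. cmod (\<psi> x) = 1) \<and> (\<forall>x y. \<psi> (x + y) = \<psi> x * \<psi> y)"
  by (simp add: dual_def character_def)

lemma dual_0: "\<psi> \<in> dual \<Longrightarrow> \<psi> 0 = 1"
  unfolding dual_def using character_0 by blast

lemma dual_nat_mult: "\<psi> \<in> dual \<Longrightarrow> \<psi> (nat_mult n x) = \<psi> x ^ n"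
  by (induction n) (auto simp: dual_0 dual_iff)

lemma dual_nonzero: "\<psi> \<in> dual \<Longrightarrow> \<psi> x \<noteq> 0"
  by (metis dual_iff norm_zero zero_neq_one)

lemma one_in_dual: "(\<lambda>_. 1) \<in> dual"
  by (simp add: dual_iff)

lemma mult_in_dual: "\<psi> \<in> dual \<Longrightarrow> \<phi> \<in> dual \<Longrightarrow> (\<lambda>x. \<psi> x * \<phi> x) \<in> dual"
  by (simp add: dual_iff norm_mult)

lemma cnj_in_dual: "\<psi> \<in> dual \<Longrightarrow> (\<lambda>x. cnj (\<psi> x)) \<in> dual"
  by (simp add: dual_iff)

text \<open>A character nontrivial at \<open>a\<close> is first defined on the cyclic subgroup
  generated by \<open>a\<close>, then enlarged one generator at a time without changing its value at
  \<open>a\<close>.\<close>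

lemma dual_separates:
  fixes a :: "'a::{finite, ab_group_add}"
  assumes "a \<noteq> 0"
  obtains \<psi> where "\<psi> \<in> dual" "\<psi> a \<noteq> 1"
proof -
  define P where "P K \<longleftrightarrow> (\<exists>\<phi>. partial_character K \<phi> \<and> a \<in> K \<and> \<phi> a \<noteq> 1)" for K
  have "\<exists>K. P K"
  proof -
    have triv: "partial_character {0} (\<lambda>_::'a. 1)" by (simp add: partial_character_def)
    obtain n where n: "n > 0" "nat_mult n a \<in> {0}"
        "\<And>m. 0 < m \<Longrightarrow> m < n \<Longrightarrow> nat_mult m a \<notin> {0}"
      using ex_least_nat_mult_in[of "{0}" a] by auto
    have "n \<noteq> 1" using n(2) assms by auto
    then have n2: "n \<ge> 2" using n(1) by simp
    \<comment> \<open>\<open>n\<close> is the order of \<open>a\<close>, so any \<open>n\<close>-th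
      root of unity is a legal value at \<open>a\<close>; this one differs from 1 because
      \<open>n\<close> is at least 2.\<close>
    let ?w = "cis (2 * pi / n)"
    have "?w ^ n = 1" using n(1) by (subst Complex.DeMoivre) simp
    moreover have "?w \<noteq> 1"
    proof
      assume "?w = 1"
      then have c: "cos (2 * pi / n) = 1" by (simp add: complex_eq_iff)
      have "2 * pi / n \<le> pi" "0 < 2 * pi / n" using n2 by (auto simp: field_simps)
      then show False using cos_monotone_0_pi[of 0 "2 * pi / n"] c by simp
    qed
    ultimately show ?thesis
      using partial_character_extend[OF triv n, of ?w] unfolding P_def
      by (metis norm_cis)
  qed
  then obtain K0 where "P K0" by blast
  \<comment> \<open>Subsets of a finite group have bounded size, so a domain of greatest cardinality
    takes the place of a maximal element from Zorn's lemma.\<close>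
  then have "\<exists>K. P K \<and> (\<forall>K'. P K' \<longrightarrow> card K' \<le> card K)"
    by (intro ex_has_greatest_nat[of P K0 card "CARD('a) + 1"])
       (auto simp: less_Suc_eq_le card_mono)
  then obtain K \<phi> where K: "partial_character K \<phi>" "a \<in> K" "\<phi> a \<noteq> 1"
      and max: "\<And>K'. P K' \<Longrightarrow> card K' \<le> card K"
    unfolding P_def by blast
  have "K = UNIV"
  proof (rule ccontr)
    assume "K \<noteq> UNIV"
    then obtain g where g: "g \<notin> K" by blast
    have "0 \<in> K" using K(1) by (simp add: partial_character_def)
    then obtain n where n: "n > 0" "nat_mult n g \<in> K"
        "\<And>m. 0 < m \<Longrightarrow> m < n \<Longrightarrow> nat_mult m g \<notin> K"
      using ex_least_nat_mult_in[of K g] by metis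
    have "cmod (\<phi> (nat_mult n g)) = 1" using K(1) n(2) by (simp add: partial_character_def)
    then obtain w where "cmod w = 1" "w ^ n = \<phi> (nat_mult n g)" using ex_unit_root n(1) by metis
    from partial_character_extend[OF K(1) n this]
    obtain K' \<phi>' where K': "partial_character K' \<phi>'" "K \<subseteq> K'" "g \<in> K'" "\<forall>x\<in>K. \<phi>' x = \<phi> x"
      by blast
    then have "P K'" unfolding P_def using K by (intro exI[of _ \<phi>']) auto
    moreover have "card K < card K'" using K' g by (intro psubset_card_mono) auto
    ultimately show False using max by fastforce
  qed
  then have "\<phi> \<in> dual" using K(1) by (simp add: dual_iff partial_character_def)
  then show ?thesis using that K(3) by blast
qed

text \<open>The value at \<open>x\<close> is a root of unity whose order divides a period of
  \<open>x\<close>, so only finitely many values are possible at each point.\<close>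

lemma finite_dual: "finite (dual :: ('a::{finite, ab_group_add} \<Rightarrow> complex) set)"
proof -
  obtain n :: "'a \<Rightarrow> nat" where n: "n x > 0" "nat_mult (n x) x = 0" for x
    using nat_mult_period by metis
  have "dual \<subseteq> (\<Pi>\<^sub>E x\<in>UNIV. {z. z ^ n x = 1})"
    by (auto simp: PiE_UNIV_domain dual_nat_mult[symmetric] n(2) dual_0)
  moreover have "finite (\<Pi>\<^sub>E x\<in>UNIV. {z :: complex. z ^ n x = 1})"
    using n(1) by (intro finite_PiE finite_roots_unity) (auto simp: Suc_le_eq)
  ultimately show ?thesis by (rule finite_subset)
qed

lemma card_dual_pos: "card (dual :: ('a::{finite, ab_group_add} \<Rightarrow> complex) set) > 0"
  using finite_dual one_in_dual by (metis card_gt_0_iff empty_iff)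

text \<open>For nonzero \<open>a\<close>, pick a character \<open>\<phi>\<close> with
  \<open>\<phi> a \<noteq> 1\<close>. Multiplication by \<open>\<phi>\<close> permutes the dual,
  with inverse given by its conjugate, so the sum equals itself times \<open>\<phi> a\<close> and
  vanishes.\<close>

lemma sum_dual:
  fixes a :: "'a::{finite, ab_group_add}"
  shows "(\<Sum>\<psi>\<in>dual. \<psi> a) = (if a = 0 then of_nat (card (dual :: ('a \<Rightarrow> complex) set)) else 0)"
proof (cases "a = 0")
  case True
  then show ?thesis by (simp add: dual_0)
next
  case False
  then obtain \<phi> where \<phi>: "\<phi> \<in> dual" "\<phi> a \<noteq> 1" using dual_separates by blast
  have inv: "cnj (\<phi> x) * \<phi> x = 1" for x
    using \<phi>(1) by (simp add: dual_iff complex_norm_square[symmetric] mult.commute)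
  have "(\<Sum>\<psi>\<in>dual. \<psi> a) = (\<Sum>\<psi>\<in>dual. \<phi> a * \<psi> a)"
    by (rule sum.reindex_bij_witness[of _ "\<lambda>\<psi> x. \<phi> x * \<psi> x" "\<lambda>\<psi> x. cnj (\<phi> x) * \<psi> x"])
       (use inv in \<open>auto simp: mult_in_dual cnj_in_dual \<phi>(1) mult.assoc[symmetric] mult.commute[of "\<phi> _"]\<close>)
  also have "\<dots> = \<phi> a * (\<Sum>\<psi>\<in>dual. \<psi> a)" by (simp add: sum_distrib_left)
  finally show ?thesis using \<phi>(2) False by simp
qed

text \<open>The mirror image of the previous argument, with translation of the group by a point
  where the character is not 1.\<close>

lemma sum_nontrivial_dual:
  fixes \<psi> :: "'a::{finite, ab_group_add} \<Rightarrow> complex"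
  assumes "\<psi> \<in> dual" "nontrivial \<psi>"
  shows "(\<Sum>a\<in>UNIV. \<psi> a) = 0"
proof -
  obtain b where b: "\<psi> b \<noteq> 1" using assms(2) by (auto simp: nontrivial_def)
  have "(\<Sum>a\<in>UNIV. \<psi> a) = (\<Sum>a\<in>UNIV. \<psi> (b + a))"
    by (rule sum.reindex_bij_witness[of _ "\<lambda>a. b + a" "\<lambda>a. a - b"]) auto
  also have "\<dots> = \<psi> b * (\<Sum>a\<in>UNIV. \<psi> a)"
    using assms(1) by (simp add: dual_iff sum_distrib_left)
  finally show ?thesis using b by simp
qed

subsection \<open>Sets of lower density 1\<close>

text \<open>Counting the complement turns density 1 into convergence to 0 of a quantity that is
  subadditive under intersections.\<close>

definition missing :: "nat set \<Rightarrow> nat \<Rightarrow> nat" where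
  "missing X n = card {i. i \<notin> X \<and> i \<le> n}"

lemma lower_density_eq_1_iff:
  "lower_density X = 1 \<longleftrightarrow> (\<lambda>n. real (missing X n) / real n) \<longlonglongrightarrow> 0"
proof -
  let ?r = "\<lambda>n. real (card {i \<in> X. i \<le> n}) / real n"
  \<comment> \<open>Times start at 0, so there are \<open>n + 1\<close> of them up to
    \<open>n\<close>, while the density divides by \<open>n\<close>; the quotient still tends to
    1.\<close>
  let ?u = "\<lambda>n. real (n + 1) / real n"
  have split: "real (card {i \<in> X. i \<le> n}) = real (n + 1) - real (missing X n)" for n
  proof -
    have "card ({i \<in> X. i \<le> n} \<union> {i. i \<notin> X \<and> i \<le> n}) = card {i \<in> X. i \<le> n} + missing X n"
      unfolding missing_def by (intro card_Un_disjoint) auto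
    moreover have "{i \<in> X. i \<le> n} \<union> {i. i \<notin> X \<and> i \<le> n} = {..n}" by auto
    ultimately show ?thesis by simp
  qed
  have u: "?u \<longlonglongrightarrow> 1" using LIMSEQ_Suc_n_over_n[where 'a = real] by simp
  have r_eq: "?r n = ?u n - real (missing X n) / real n" for n
    by (simp only: split diff_divide_distrib)
  show ?thesis
  proof
    assume "lower_density X = 1"
    then have low: "liminf (\<lambda>n. ereal (?r n)) = 1" by (simp add: lower_density_def)
    \<comment> \<open>The hypothesis controls only the lower limit. The ratio never exceeds
      \<open>?u\<close>, which caps the upper limit at 1 and yields genuine convergence.\<close>
    have "limsup (\<lambda>n. ereal (?r n)) \<le> limsup (\<lambda>n. ereal (?u n))"
      by (intro Limsup_mono always_eventually allI) (simp add: split divide_right_mono)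
    also have "\<dots> = 1"
      using u by (intro lim_imp_Limsup) (auto simp: one_ereal_def)
    finally have "(\<lambda>n. ereal (?r n)) \<longlonglongrightarrow> 1"
      using low by (intro Liminf_eq_Limsup) (auto intro!: antisym Liminf_le_Limsup[THEN order_trans[rotated]])
    then have "?r \<longlonglongrightarrow> 1" by (simp add: one_ereal_def)
    then have "(\<lambda>n. ?u n - ?r n) \<longlonglongrightarrow> 1 - 1" using u by (intro tendsto_diff)
    then show "(\<lambda>n. real (missing X n) / real n) \<longlonglongrightarrow> 0" by (simp add: r_eq)
  next
    assume "(\<lambda>n. real (missing X n) / real n) \<longlonglongrightarrow> 0"
    then have "(\<lambda>n. ?u n - real (missing X n) / real n) \<longlonglongrightarrow> 1 - 0" using u by (intro tendsto_diff)
    then have "?r \<longlonglongrightarrow> 1" by (simp add: r_eq)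
    then show "lower_density X = 1"
      unfolding lower_density_def by (intro lim_imp_Liminf) (auto simp: one_ereal_def)
  qed
qed

lemma lower_density_1_infinite:
  assumes "lower_density X = 1"
  shows "infinite X"
proof
  assume "finite X"
  have "card {i \<in> X. i \<le> n} \<le> card X" for n
    using \<open>finite X\<close> by (intro card_mono) auto
  then have "liminf (\<lambda>n. ereal (real (card {i \<in> X. i \<le> n}) / real n))
      \<le> liminf (\<lambda>n. ereal (real (card X) / real n))"
    by (intro Liminf_mono always_eventually allI) (simp add: divide_right_mono)
  also have "\<dots> = 0"
  proof (rule lim_imp_Liminf)
    have "(\<lambda>n. real (card X) / real n) \<longlonglongrightarrow> 0" by (rule lim_const_over_n)
    then show "(\<lambda>n. ereal (real (card X) / real n)) \<longlonglongrightarrow> 0" by (simp add: zero_ereal_def)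
  qed simp
  finally show False using assms by (simp add: lower_density_def)
qed

lemma lower_density_1_finite_Inter:
  assumes "finite I" "\<And>i. i \<in> I \<Longrightarrow> lower_density (X i) = 1"
  shows "lower_density (\<Inter>i\<in>I. X i) = 1"
  unfolding lower_density_eq_1_iff
proof (rule tendsto_sandwich[OF always_eventually always_eventually tendsto_const])
  show "\<forall>n. 0 \<le> real (missing (\<Inter>i\<in>I. X i) n) / real n" by simp
  show "\<forall>n. real (missing (\<Inter>i\<in>I. X i) n) / real n \<le> (\<Sum>i\<in>I. real (missing (X i) n) / real n)"
  proof
    fix n
    have "missing (\<Inter>i\<in>I. X i) n = card (\<Union>i\<in>I. {j. j \<notin> X i \<and> j \<le> n})"
      unfolding missing_def by (intro arg_cong[where f = card]) auto
    also have "\<dots> \<le> (\<Sum>i\<in>I. missing (X i) n)"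
      unfolding missing_def using assms(1) by (rule card_UN_le)
    finally have "real (missing (\<Inter>i\<in>I. X i) n) \<le> (\<Sum>i\<in>I. real (missing (X i) n))"
      using of_nat_mono by fastforce
    then show "real (missing (\<Inter>i\<in>I. X i) n) / real n \<le> (\<Sum>i\<in>I. real (missing (X i) n) / real n)"
      by (simp add: sum_divide_distrib[symmetric] divide_right_mono)
  qed
  show "(\<lambda>n. \<Sum>i\<in>I. real (missing (X i) n) / real n) \<longlonglongrightarrow> 0"
    using assms(2) by (intro tendsto_null_sum) (simp add: lower_density_eq_1_iff)
qed

text \<open>The set \<open>J\<close> obeys more and more of the constraints \<open>X k\<close> as
  time grows, and a further constraint is imposed only from a time on at which it has become
  cheap.\<close>

lemma lower_density_1_diagonal:
  fixes X :: "nat \<Rightarrow> nat set"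
  assumes "\<And>k. lower_density (X k) = 1"
  obtains J where "lower_density J = 1" "\<And>k. finite (J - X k)"
proof -
  define D where "D m = (\<Inter>k\<in>{..m}. X k)" for m
  have D: "(\<lambda>n. real (missing (D m) n) / real n) \<longlonglongrightarrow> 0" for m
    using lower_density_1_finite_Inter[of "{..m}" X] assms
    by (simp add: D_def lower_density_eq_1_iff)
  have "\<exists>N. \<forall>n\<ge>N. real (missing (D m) n) / real n \<le> 1 / Suc m" for m
    using order_tendstoD(2)[OF D, of "1 / Suc m" m]
    by (auto simp: eventually_sequentially intro: less_imp_le)
  then obtain N where N: "\<And>m n. n \<ge> N m \<Longrightarrow> real (missing (D m) n) / real n \<le> 1 / Suc m"
    by metis
  \<comment> \<open>Level \<open>m\<close> is active at time \<open>i\<close> when both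
    \<open>m\<close> and \<open>N m\<close> are at most \<open>i\<close>. The condition on
    \<open>m\<close> itself leaves finitely many active levels at each time, so a highest one can be
    taken although \<open>N\<close> need not be monotone.\<close>
  define J where "J = {i. \<forall>m\<le>i. N m \<le> i \<longrightarrow> i \<in> D m}"
  have key: "real (missing J n) / real n \<le> 1 / Suc m" if n: "n \<ge> max m (N m)" for m n
  proof -
    \<comment> \<open>The highest active level at time \<open>n\<close>. A time up to
      \<open>n\<close> that is missing from \<open>J\<close> violates some level active then, hence
      one not above \<open>M\<close>; since the sets \<open>D\<close> decrease, it is missing from
      \<open>D M\<close> too.\<close>
    define M where "M = (GREATEST m. m \<le> n \<and> N m \<le> n)"
    have M: "M \<le> n" "N M \<le> n" and mM: "m \<le> M"
      and max: "\<And>m'. m' \<le> n \<Longrightarrow> N m' \<le> n \<Longrightarrow> m' \<le> M"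
      using GreatestI_nat[of "\<lambda>m. m \<le> n \<and> N m \<le> n" m n] Greatest_le_nat[of "\<lambda>m. m \<le> n \<and> N m \<le> n" _ n] n
      by (auto simp: M_def)
    have "{i. i \<notin> J \<and> i \<le> n} \<subseteq> {i. i \<notin> D M \<and> i \<le> n}"
    proof safe
      fix i assume i: "i \<notin> J" "i \<le> n" "i \<in> D M"
      have "i \<in> D m'" if "m' \<le> i" "N m' \<le> i" for m'
        using max[of m'] that i(2,3) by (auto simp: D_def)
      then show False using i(1) by (auto simp: J_def)
    qed
    then have "missing J n \<le> missing (D M) n"
      unfolding missing_def by (intro card_mono) auto
    then have "real (missing J n) / real n \<le> real (missing (D M) n) / real n"
      by (simp add: divide_right_mono)
    also have "\<dots> \<le> 1 / Suc M" using N M by blast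
    also have "\<dots> \<le> 1 / Suc m" using mM by (simp add: field_simps)
    finally show ?thesis .
  qed
  have "(\<lambda>n. real (missing J n) / real n) \<longlonglongrightarrow> 0"
  proof (rule LIMSEQ_I)
    fix r :: real assume "r > 0"
    then obtain m where m: "1 / Suc m < r" using reals_Archimedean[of r] by (auto simp: inverse_eq_divide)
    show "\<exists>no. \<forall>n\<ge>no. norm (real (missing J n) / real n - 0) < r"
    proof (intro exI allI impI)
      fix n assume "n \<ge> max m (N m)"
      from key[OF this] m show "norm (real (missing J n) / real n - 0) < r" by simp
    qed
  qed
  moreover have "finite (J - X k)" for k
  proof (rule finite_subset)
    show "J - X k \<subseteq> {..max k (N k)}"
    proof
      fix x assume x: "x \<in> J - X k"
      then have "x \<notin> D k" by (auto simp: D_def)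
      then have "\<not> (k \<le> x \<and> N k \<le> x)" using x by (auto simp: J_def)
      then show "x \<in> {..max k (N k)}" by auto
    qed
  qed simp
  ultimately show ?thesis using that by (auto simp: lower_density_eq_1_iff)
qed

section \<open>From sets of times to sequences of times\<close>

text \<open>The right-hand side sees only the range of the sequence, so sequences may be exchanged
  for sets of times, on which finitely many exceptions are invisible.\<close>

lemma filterlim_at_top_comp_iff:
  fixes r :: "nat \<Rightarrow> nat"
  assumes "strict_mono \<phi>"
  shows "filterlim (\<lambda>t. r (\<phi> t)) at_top sequentially \<longleftrightarrow> (\<forall>R. finite {t \<in> range \<phi>. r t < R})"
proof -
  have inj: "inj \<phi>" using assms by (rule strict_mono_imp_inj_on)
  have "{t \<in> range \<phi>. r t < R} = \<phi> ` {t. r (\<phi> t) < R}" for R by auto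
  then have "finite {t \<in> range \<phi>. r t < R} \<longleftrightarrow> finite {t. r (\<phi> t) < R}" for R
    using inj by (simp add: finite_image_iff inj_on_subset)
  moreover have "eventually (\<lambda>t. R \<le> r (\<phi> t)) sequentially \<longleftrightarrow> finite {t. r (\<phi> t) < R}" for R
    by (simp add: cofinite_eq_sequentially[symmetric] eventually_cofinite not_le)
  ultimately show ?thesis by (simp add: filterlim_at_top)
qed

lemma common_density_sequence:
  fixes r :: "'i \<Rightarrow> nat \<Rightarrow> nat"
  assumes "countable I"
    and "\<And>i. i \<in> I \<Longrightarrow> \<exists>\<phi>. strict_mono \<phi> \<and> lower_density (range \<phi>) = 1 \<and>
            filterlim (\<lambda>t. r i (\<phi> t)) at_top sequentially"
  obtains \<phi> where "strict_mono \<phi>" "lower_density (range \<phi>) = 1"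
    "\<And>i. i \<in> I \<Longrightarrow> filterlim (\<lambda>t. r i (\<phi> t)) at_top sequentially"
proof -
  have "\<forall>i. \<exists>X. lower_density X = 1 \<and> (i \<in> I \<longrightarrow> (\<forall>R. finite {t \<in> X. r i t < R}))"
  proof
    fix i
    show "\<exists>X. lower_density X = 1 \<and> (i \<in> I \<longrightarrow> (\<forall>R. finite {t \<in> X. r i t < R}))"
    proof (cases "i \<in> I")
      case True
      then show ?thesis using assms(2)[OF True] filterlim_at_top_comp_iff by blast
    next
      case False
      \<comment> \<open>If \<open>I\<close> is empty, \<open>from_nat_into\<close> takes values
        outside \<open>I\<close>; the default \<open>UNIV\<close> keeps the diagonal lemma
        applicable there.\<close>
      have "lower_density UNIV = 1" by (simp add: lower_density_eq_1_iff missing_def)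
      then show ?thesis using False by blast
    qed
  qed
  then obtain X where X: "\<And>i. lower_density (X i) = 1"
      "\<And>i R. i \<in> I \<Longrightarrow> finite {t \<in> X i. r i t < R}"
    by metis
  obtain J where J: "lower_density J = 1" "\<And>k. finite (J - X (from_nat_into I k))"
    using lower_density_1_diagonal[of "\<lambda>k. X (from_nat_into I k)"] X(1) by blast
  have inf: "infinite J" using J(1) by (rule lower_density_1_infinite)
  have mono: "strict_mono (enumerate J)" using inf by (rule strict_mono_enumerate)
  have ran: "range (enumerate J) = J" using inf by (rule range_enumerate)
  have "finite {t \<in> J. r i t < R}" if i: "i \<in> I" for i R
  proof -
    have "finite (J - X i)" using J(2)[of "to_nat_on I i"] from_nat_into_to_nat_on[OF assms(1) i] by simp
    then show ?thesis
      using X(2)[OF i, of R] by (rule_tac finite_subset[of _ "(J - X i) \<union> {t \<in> X i. r i t < R}"]) auto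
  qed
  then show ?thesis
    using that[OF mono] ran J(1) filterlim_at_top_comp_iff[OF mono] by metis
qed

subsection \<open>Cylinders and weak convergence\<close>

text \<open>For finite \<open>S\<close> this covers both indicators of cylinders and characters, so
  continuity and integration are settled once for both.\<close>

definition local_on :: "int set \<Rightarrow> ('a config \<Rightarrow> 'b) \<Rightarrow> bool" where
  "local_on S f \<longleftrightarrow> (\<forall>x y. (\<forall>i\<in>S. x i = y i) \<longrightarrow> f x = f y)"

lemma topspace_config [simp]: "topspace config_topology = UNIV"
  by (simp add: config_topology_def)

lemma space_config_borel [simp]: "space config_borel = UNIV"
  by (simp add: config_borel_def space_measure_of_conv)

lemma local_on_continuous:
  fixes f :: "'a config \<Rightarrow> 'b::topological_space"
  assumes "finite S" "local_on S f"
  shows "continuous_map config_topology euclidean f"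
  unfolding continuous_map_def
proof (intro conjI allI impI)
  fix W :: "'b set"
  show "openin config_topology {x \<in> topspace config_topology. f x \<in> W}"
    unfolding openin_config_topology
  proof
    fix x assume x: "x \<in> {x \<in> topspace config_topology. f x \<in> W}"
    define V where "V i = (if i \<in> S then {x i} else UNIV)" for i
    have "i \<in> S" if "V i \<noteq> UNIV" for i
      using that by (metis V_def)
    then have "finite {i. V i \<noteq> UNIV}"
      by (intro finite_subset[OF _ assms(1)]) blast
    moreover have "\<forall>i. x i \<in> V i" by (simp add: V_def)
    moreover have "f y \<in> W" if "\<forall>i. y i \<in> V i" for y
    proof -
      have "f y = f x"
        using assms(2) that unfolding local_on_def V_def by (metis singletonD)
      then show ?thesis using x by simp
    qed
    ultimately show "\<exists>V. finite {i. V i \<noteq> UNIV} \<and> (\<forall>i. x i \<in> V i) \<and>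
        (\<forall>y. (\<forall>i. y i \<in> V i) \<longrightarrow> y \<in> {x \<in> topspace config_topology. f x \<in> W})"
      by (intro exI[of _ V]) simp
  qed
qed auto

lemma continuous_map_borel_measurable:
  fixes f :: "'a config \<Rightarrow> 'b::topological_space"
  assumes "continuous_map config_topology euclidean f"
  shows "f \<in> borel_measurable config_borel"
proof (rule borel_measurableI)
  fix W :: "'b set" assume "open W"
  then have "openin config_topology {x. f x \<in> W}"
    using openin_continuous_map_preimage[OF assms, of W] by simp
  then have "{x. f x \<in> W} \<in> sets config_borel"
    unfolding config_borel_def by (simp add: sets_measure_of_conv sigma_sets.Basic)
  moreover have "f -` W \<inter> space config_borel = {x. f x \<in> W}" by auto
  ultimately show "f -` W \<inter> space config_borel \<in> sets config_borel" by simp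
qed

lemma borel_prob_measuresD:
  assumes "M \<in> borel_prob_measures"
  shows "prob_space M" "sets M = sets config_borel" "space M = UNIV"
  using assms sets_eq_imp_space_eq[of M config_borel] by (auto simp: borel_prob_measures_def)

lemma integrable_continuous:
  fixes f :: "'a config \<Rightarrow> 'b::{banach, second_countable_topology}"
  assumes "M \<in> borel_prob_measures" "continuous_map config_topology euclidean f" "\<And>x. norm (f x) \<le> B"
  shows "integrable M f"
proof -
  interpret prob_space M using assms(1) by (rule borel_prob_measuresD)
  have "f \<in> borel_measurable M"
    using continuous_map_borel_measurable[OF assms(2)] borel_prob_measuresD(2)[OF assms(1)]
    by (simp cong: measurable_cong_sets)
  then show ?thesis using assms(3) by (intro integrable_const_bound[of _ B]) auto
qed

lemma local_on_cylinder: "local_on S (indicator (cylinder S u))"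
  by (auto simp: local_on_def cylinder_def indicator_def)

lemma sets_cylinder:
  assumes "finite S"
  shows "cylinder S u \<in> sets config_borel"
proof -
  have "(indicator (cylinder S u) :: _ \<Rightarrow> real) \<in> borel_measurable config_borel"
    using assms local_on_cylinder by (intro continuous_map_borel_measurable local_on_continuous)
  then show ?thesis by (simp add: borel_measurable_indicator_iff)
qed

text \<open>Extensional functions supply exactly one representative per pattern on \<open>S\<close>,
  so only the term of the pattern of \<open>x\<close> survives.\<close>

lemma local_on_eq_sum:
  fixes f :: "('a::finite) config \<Rightarrow> 'b::real_vector"
  assumes "finite S" "local_on S f"
  shows "f x = (\<Sum>u\<in>S \<rightarrow>\<^sub>E UNIV. indicator (cylinder S u) x *\<^sub>R f u)"
proof -
  have "indicator (cylinder S u) x *\<^sub>R f u = (if u = restrict x S then f x else 0)"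
    if "u \<in> S \<rightarrow>\<^sub>E UNIV" for u
  proof -
    have "x \<in> cylinder S u \<longleftrightarrow> u = restrict x S"
      using that by (auto simp: cylinder_def PiE_iff extensional_def restrict_def fun_eq_iff)
    moreover have "f (restrict x S) = f x"
      using assms(2) by (auto simp: local_on_def)
    ultimately show ?thesis by (auto simp: indicator_def)
  qed
  then have "(\<Sum>u\<in>S \<rightarrow>\<^sub>E UNIV. indicator (cylinder S u) x *\<^sub>R f u)
      = (\<Sum>u\<in>S \<rightarrow>\<^sub>E UNIV. if u = restrict x S then f x else 0)"
    by (intro sum.cong) auto
  also have "\<dots> = f x"
    using assms(1) by (simp add: sum.delta finite_PiE)
  finally show ?thesis by simp
qed

lemma integral_local_on:
  fixes f :: "('a::finite) config \<Rightarrow> 'b::{banach, second_countable_topology}"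
  assumes "M \<in> borel_prob_measures" "finite S" "local_on S f"
  shows "(\<integral>x. f x \<partial>M) = (\<Sum>u\<in>S \<rightarrow>\<^sub>E UNIV. measure M (cylinder S u) *\<^sub>R f u)"
proof -
  interpret prob_space M using assms(1) by (rule borel_prob_measuresD)
  have sets: "cylinder S u \<in> sets M" for u
    using sets_cylinder[OF assms(2)] borel_prob_measuresD(2)[OF assms(1)] by simp
  have "(\<integral>x. f x \<partial>M) = (\<integral>x. (\<Sum>u\<in>S \<rightarrow>\<^sub>E UNIV. indicator (cylinder S u) x *\<^sub>R f u) \<partial>M)"
    by (intro Bochner_Integration.integral_cong refl local_on_eq_sum[OF assms(2,3)])
  also have "\<dots> = (\<Sum>u\<in>S \<rightarrow>\<^sub>E UNIV. \<integral>x. indicator (cylinder S u) x *\<^sub>R f u \<partial>M)"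
    using sets by (intro Bochner_Integration.integral_sum) (auto simp: emeasure_eq_measure)
  also have "\<dots> = (\<Sum>u\<in>S \<rightarrow>\<^sub>E UNIV. measure M (cylinder S u) *\<^sub>R f u)"
    using sets by (intro sum.cong) (auto simp: emeasure_eq_measure)
  finally show ?thesis .
qed

text \<open>Compactness of the configuration space: finitely many cylinders, on each of which
  \<open>f\<close> stays within half of \<open>\<epsilon>\<close> of its value at the centre, cover
  everything. The union of their coordinate sets works, since two points agreeing there lie in a
  common cylinder of the cover.\<close>

lemma continuous_uniformly_local:
  fixes f :: "('a::finite) config \<Rightarrow> real"
  assumes "continuous_map config_topology euclidean f" "\<epsilon> > 0"
  obtains S where "finite S" "\<And>x y. \<forall>i\<in>S. x i = y i \<Longrightarrow> \<bar>f x - f y\<bar> < \<epsilon>"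
proof -
  have "\<exists>S. finite S \<and> (\<forall>y\<in>cylinder S x. \<bar>f y - f x\<bar> < \<epsilon> / 2)" for x
  proof -
    have "openin config_topology {y. f y \<in> ball (f x) (\<epsilon> / 2)}"
      using openin_continuous_map_preimage[OF assms(1), of "ball (f x) (\<epsilon> / 2)"] by simp
    moreover have "x \<in> {y. f y \<in> ball (f x) (\<epsilon> / 2)}" using assms(2) by simp
    ultimately obtain V where V: "finite {i. V i \<noteq> UNIV}" "\<forall>i. x i \<in> V i"
        "\<forall>y. (\<forall>i. y i \<in> V i) \<longrightarrow> y \<in> {y. f y \<in> ball (f x) (\<epsilon> / 2)}"
      unfolding openin_config_topology by blast
    have "\<bar>f y - f x\<bar> < \<epsilon> / 2" if "y \<in> cylinder {i. V i \<noteq> UNIV} x" for y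
    proof -
      have "y i \<in> V i" for i
        using that V(2) by (cases "V i = UNIV") (auto simp: cylinder_def)
      then have "f y \<in> ball (f x) (\<epsilon> / 2)" using V(3) by blast
      then show ?thesis by (simp add: dist_real_def abs_minus_commute)
    qed
    then show ?thesis using V(1) by blast
  qed
  then obtain S where S: "\<And>x. finite (S x)"
      "\<And>x y. y \<in> cylinder (S x) x \<Longrightarrow> \<bar>f y - f x\<bar> < \<epsilon> / 2"
    by metis
  have comp: "compact_space (config_topology :: 'a config topology)"
    unfolding config_topology_def compact_space_product_topology
    by (simp add: compact_space_discrete_topology)
  \<comment> \<open>The cylinder is the set where its continuous indicator exceeds 1/2.\<close>
  have "openin config_topology (cylinder (S x) x)" for x
    using openin_continuous_map_preimage
      [OF local_on_continuous[OF S(1) local_on_cylinder[of "S x" x]], of "{1 / 2 <..} :: real set"]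
    by (simp add: indicator_def of_bool_def split: if_splits)
  then obtain \<F> where \<F>: "finite \<F>" "\<F> \<subseteq> range (\<lambda>x. cylinder (S x) x)" "\<Union>\<F> = UNIV"
    using comp[unfolded compact_space_alt, rule_format, of "range (\<lambda>x. cylinder (S x) x)"]
    by (auto simp: cylinder_def)
  then obtain X where X: "finite X" "\<F> = (\<lambda>x. cylinder (S x) x) ` X"
    by (meson finite_subset_image)
  have "\<bar>f x - f y\<bar> < \<epsilon>" if "\<forall>i\<in>(\<Union>z\<in>X. S z). x i = y i" for x y
  proof -
    obtain z where z: "z \<in> X" "x \<in> cylinder (S z) z" using \<F>(3) X(2) by auto
    then have "y \<in> cylinder (S z) z" using that by (auto simp: cylinder_def)
    then show ?thesis using S(2)[of x z] S(2)[of y z] z(2) by linarith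
  qed
  then show ?thesis using that[of "\<Union>z\<in>X. S z"] X(1) S(1) by blast
qed

lemma weak_star_conv_iff_cylinders:
  fixes M :: "nat \<Rightarrow> ('a::finite) config measure"
  assumes M: "\<And>t. M t \<in> borel_prob_measures" and N: "N \<in> borel_prob_measures"
  shows "weak_star_conv M N \<longleftrightarrow>
    (\<forall>S u. finite S \<longrightarrow> (\<lambda>t. measure (M t) (cylinder S u)) \<longlonglongrightarrow> measure N (cylinder S u))"
proof (intro iffI allI impI)
  fix S :: "int set" and u :: "'a config"
  assume w: "weak_star_conv M N" and S: "finite S"
  have eq: "(\<integral>x. indicator (cylinder S u) x \<partial>K) = measure K (cylinder S u)"
    if "K \<in> borel_prob_measures" for K :: "'a config measure"
    using borel_prob_measuresD(3)[OF that] by simp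
  have "(\<lambda>t. \<integral>x. indicator (cylinder S u) x \<partial>M t) \<longlonglongrightarrow> (\<integral>x. indicator (cylinder S u) x \<partial>N :: real)"
    using w local_on_continuous[OF S local_on_cylinder] unfolding weak_star_conv_def by blast
  then show "(\<lambda>t. measure (M t) (cylinder S u)) \<longlonglongrightarrow> measure N (cylinder S u)"
    by (simp only: eq[OF M] eq[OF N])
next
  assume c: "\<forall>S u. finite S \<longrightarrow> (\<lambda>t. measure (M t) (cylinder S u)) \<longlonglongrightarrow> measure N (cylinder S u)"
  show "weak_star_conv M N"
    unfolding weak_star_conv_def
  proof (intro allI impI)
    fix f :: "'a config \<Rightarrow> real" assume f: "continuous_map config_topology euclidean f"
    show "(\<lambda>t. \<integral>x. f x \<partial>M t) \<longlonglongrightarrow> (\<integral>x. f x \<partial>N)"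
    proof (rule LIMSEQ_I)
      fix r :: real assume r: "r > 0"
      then obtain S where S: "finite S" "\<And>x y. \<forall>i\<in>S. x i = y i \<Longrightarrow> \<bar>f x - f y\<bar> < r / 3"
        using continuous_uniformly_local[OF f, of "r / 3"] by (metis divide_pos_pos zero_less_numeral)
      \<comment> \<open>\<open>restrict\<close> fills the coordinates outside \<open>S\<close> with
        one fixed value. Hence \<open>g\<close> depends on \<open>S\<close> alone, and it is
        uniformly close to \<open>f\<close> because the filled point agrees with \<open>x\<close> on
        \<open>S\<close>.\<close>
      define g where "g x = f (restrict x S)" for x
      have loc: "local_on S g"
        unfolding local_on_def g_def by (metis restrict_ext)
      have cont: "continuous_map config_topology euclidean g"
        using local_on_continuous[OF S(1) loc] .
      have fg: "\<bar>f x - g x\<bar> < r / 3" for x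
        unfolding g_def by (rule S(2)) simp
      have fin: "finite (S \<rightarrow>\<^sub>E (UNIV :: 'a set))" using S(1) by (simp add: finite_PiE)
      \<comment> \<open>\<open>g\<close> takes only the finitely many values \<open>f u\<close> at
        patterns on \<open>S\<close>, so their absolute sum bounds it; this supplies the
        integrability of \<open>f\<close> and \<open>g\<close>.\<close>
      define B where "B = (\<Sum>u\<in>S \<rightarrow>\<^sub>E UNIV. \<bar>f u\<bar>)"
      have gB: "\<bar>g x\<bar> \<le> B" for x
        unfolding B_def g_def by (rule member_le_sum[of "restrict x S" _ "\<lambda>u. \<bar>f u\<bar>"]) (use fin in auto)
      have fB: "\<bar>f x\<bar> \<le> B + r / 3" for x using gB[of x] fg[of x] by linarith
      have close: "\<bar>(\<integral>x. f x \<partial>K) - (\<integral>x. g x \<partial>K)\<bar> \<le> r / 3" if K: "K \<in> borel_prob_measures" for K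
      proof -
        interpret prob_space K using K by (rule borel_prob_measuresD)
        have int: "integrable K f" "integrable K g"
          using integrable_continuous[OF K f, of "B + r / 3"] integrable_continuous[OF K cont, of B] fB gB
          by auto
        have "\<bar>(\<integral>x. f x \<partial>K) - (\<integral>x. g x \<partial>K)\<bar> = \<bar>\<integral>x. f x - g x \<partial>K\<bar>"
          using int by simp
        also have "\<dots> \<le> (\<integral>x. \<bar>f x - g x\<bar> \<partial>K)" by (rule integral_abs_bound)
        also have "\<dots> \<le> (\<integral>x. r / 3 \<partial>K)"
          using int fg by (intro integral_mono) (auto intro: less_imp_le)
        also have "\<dots> = r / 3" by (simp add: prob_space)
        finally show ?thesis .
      qed
      have "(\<lambda>t. \<integral>x. g x \<partial>M t) \<longlonglongrightarrow> (\<integral>x. g x \<partial>N)"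
        unfolding integral_local_on[OF M S(1) loc] integral_local_on[OF N S(1) loc]
        using c S(1) by (intro tendsto_sum tendsto_scaleR tendsto_const) auto
      then obtain n0 where n0: "\<And>n. n \<ge> n0 \<Longrightarrow> \<bar>(\<integral>x. g x \<partial>M n) - (\<integral>x. g x \<partial>N)\<bar> < r / 3"
        using LIMSEQ_D[of "\<lambda>t. \<integral>x. g x \<partial>M t" "\<integral>x. g x \<partial>N" "r / 3"] r by auto
      have "norm ((\<integral>x. f x \<partial>M n) - (\<integral>x. f x \<partial>N)) < r" if "n \<ge> n0" for n
        using n0[OF that] close[OF M[of n]] close[OF N] unfolding real_norm_def by linarith
      then show "\<exists>no. \<forall>n\<ge>no. norm ((\<integral>x. f x \<partial>M n) - (\<integral>x. f x \<partial>N)) < r" by blast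
    qed
  qed
qed

subsection \<open>Fourier coefficients of measures on configurations\<close>

definition prod_char :: "int set \<Rightarrow> (int \<Rightarrow> 'a \<Rightarrow> complex) \<Rightarrow> 'a config \<Rightarrow> complex" where
  "prod_char S c x = (\<Prod>k\<in>S. c k (x k))"

lemma local_on_prod_char: "local_on S (prod_char S c)"
  by (auto simp: local_on_def prod_char_def intro!: prod.cong)

lemma config_character_prod_char:
  assumes "finite S" "\<And>k. k \<in> S \<Longrightarrow> c k \<in> dual"
  shows "config_character (prod_char S c)"
  unfolding character_def
proof (intro conjI allI)
  show "continuous_map config_topology euclidean (prod_char S c)"
    using assms(1) local_on_prod_char by (rule local_on_continuous)
  show "cmod (prod_char S c x) = 1" for x
    unfolding prod_char_def prod_norm[symmetric] using assms(2) by (intro prod.neutral) (auto simp: dual_iff)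
  show "prod_char S c (x + y) = prod_char S c x * prod_char S c y" for x y
    unfolding prod_char_def prod.distrib[symmetric]
    using assms(2) by (intro prod.cong) (auto simp: dual_iff)
qed

lemma is_factorization_factor:
  assumes "config_character \<psi>"
  shows "is_factorization \<psi> (factor \<psi>)"
  unfolding factor_def by (rule theI'[OF ex1_factorization[OF assms]])

lemma factor_unique:
  assumes "config_character \<psi>" "is_factorization \<psi> c"
  shows "factor \<psi> = c"
  using ex1_factorization[OF assms(1)] is_factorization_factor[OF assms(1)] assms(2) by blast

lemma
  assumes "config_character \<psi>"
  shows factor_in_dual: "factor \<psi> k \<in> dual"
    and finite_char_supp: "finite (char_supp \<psi>)"
    and prod_char_factor: "\<psi> = prod_char (char_supp \<psi>) (factor \<psi>)"
  using is_factorization_factor[OF assms]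
  by (auto simp: is_factorization_def dual_def char_supp_def prod_char_def fun_eq_iff)

lemma factor_prod_char:
  assumes "finite S" "\<And>k. k \<in> S \<Longrightarrow> c k \<in> dual"
  shows "factor (prod_char S c) = (\<lambda>k. if k \<in> S then c k else (\<lambda>_. 1))" (is "_ = ?c")
proof (rule factor_unique[OF config_character_prod_char[OF assms]])
  have sub: "{k. nontrivial (?c k)} \<subseteq> S" by (auto simp: nontrivial_def)
  have "prod_char S c x = (\<Prod>k | nontrivial (?c k). ?c k (x k))" for x
  proof -
    have "prod_char S c x = (\<Prod>k\<in>S. ?c k (x k))"
      unfolding prod_char_def by (intro prod.cong) auto
    also have "\<dots> = (\<Prod>k | nontrivial (?c k). ?c k (x k))"
      using assms(1) sub by (intro prod.mono_neutral_right) (auto simp: nontrivial_def)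
    finally show ?thesis .
  qed
  moreover have "?c k \<in> dual" for k using assms(2) one_in_dual by auto
  ultimately show "is_factorization (prod_char S c) ?c"
    unfolding is_factorization_def using finite_subset[OF sub assms(1)] by (simp add: dual_def)
qed

lemma char_supp_prod_char:
  assumes "finite S" "\<And>k. k \<in> S \<Longrightarrow> c k \<in> dual"
  shows "char_supp (prod_char S c) = {k \<in> S. nontrivial (c k)}"
proof -
  have "factor (prod_char S c) = (\<lambda>k. if k \<in> S then c k else (\<lambda>_. 1))"
    using assms by (rule factor_prod_char)
  then show ?thesis by (auto simp: char_supp_def nontrivial_def)
qed

lemma char_supp_empty_iff:
  assumes "config_character \<psi>"
  shows "char_supp \<psi> = {} \<longleftrightarrow> \<not> nontrivial \<psi>"
proof
  assume "char_supp \<psi> = {}"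
  then show "\<not> nontrivial \<psi>"
    using prod_char_factor[OF assms] by (simp add: nontrivial_def prod_char_def fun_eq_iff)
next
  assume "\<not> nontrivial \<psi>"
  then have "\<psi> = prod_char {} (\<lambda>_ _. 1)" by (simp add: nontrivial_def prod_char_def fun_eq_iff)
  then show "char_supp \<psi> = {}" using char_supp_prod_char[of "{}" "\<lambda>_ _. 1"] by simp
qed

lemma local_on_character:
  assumes "config_character \<psi>"
  shows "local_on (char_supp \<psi>) \<psi>"
  by (subst (2) prod_char_factor[OF assms]) (rule local_on_prod_char)

text \<open>There are countably many finite supports and, for each, finitely many choices of
  factors. Countability is what allows the sequences of times of all characters to be
  merged.\<close>

lemma countable_characters:
  "countable {\<psi> :: ('a::{finite, ab_group_add}) config \<Rightarrow> complex. config_character \<psi>}"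
proof (rule countable_subset)
  let ?B = "\<lambda>S. prod_char S ` (S \<rightarrow>\<^sub>E (dual :: ('a \<Rightarrow> complex) set))"
  show "{\<psi> :: 'a config \<Rightarrow> complex. config_character \<psi>} \<subseteq> (\<Union>S\<in>{S. finite S}. ?B S)"
  proof
    fix \<psi> :: "'a config \<Rightarrow> complex" assume "\<psi> \<in> {\<psi>. config_character \<psi>}"
    then have \<psi>: "config_character \<psi>" by simp
    let ?S = "char_supp \<psi>"
    \<comment> \<open>Cutting the factors off outside the support puts them into a finite function
      space without changing the product.\<close>
    have "prod_char ?S (restrict (factor \<psi>) ?S) = prod_char ?S (factor \<psi>)"
      by (auto simp: prod_char_def intro!: prod.cong)
    then have "\<psi> = prod_char ?S (restrict (factor \<psi>) ?S)"
      using prod_char_factor[OF \<psi>] by simp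
    moreover have "restrict (factor \<psi>) ?S \<in> ?S \<rightarrow>\<^sub>E dual" using factor_in_dual[OF \<psi>] by auto
    ultimately have "\<psi> \<in> ?B ?S" by blast
    then show "\<psi> \<in> (\<Union>S\<in>{S. finite S}. ?B S)" using finite_char_supp[OF \<psi>] by blast
  qed
  show "countable (\<Union>S\<in>{S. finite S}. ?B S)"
    using countable_Collect_finite
    by (intro countable_UN) (auto intro!: countable_finite finite_imageI finite_PiE finite_dual)
qed

lemma integrable_character:
  assumes "M \<in> borel_prob_measures" "config_character \<psi>"
  shows "integrable M \<psi>"
  using assms(2) integrable_continuous[OF assms(1), of \<psi> 1] by (auto simp: character_def)

lemma fourier_coeff_trivial:
  assumes "M \<in> borel_prob_measures" "config_character \<psi>" "\<not> nontrivial \<psi>"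
  shows "fourier_coeff M \<psi> = 1"
proof -
  interpret prob_space M using assms(1) by (rule borel_prob_measuresD)
  have "\<psi> = (\<lambda>_. 1)" using assms(3) by (simp add: nontrivial_def)
  then show ?thesis by (simp add: fourier_coeff_def prob_space)
qed

text \<open>Fourier inversion on finitely many coordinates: \<open>sum_dual\<close> at
  \<open>x k - u k\<close> expresses agreement at \<open>k\<close>, and expanding the product of
  these sums yields one term for each choice of a character per coordinate.\<close>

lemma cylinder_indicator_eq:
  fixes u :: "int \<Rightarrow> 'a::{finite, ab_group_add}"
  assumes "finite S"
  shows "(indicator (cylinder S u) x :: complex) = (\<Sum>c\<in>S \<rightarrow>\<^sub>E dual.
    prod_char S c (- u) / of_nat (card (dual :: ('a \<Rightarrow> complex) set)) ^ card S * prod_char S c x)"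
proof -
  let ?N = "of_nat (card (dual :: ('a \<Rightarrow> complex) set)) :: complex"
  have N: "?N \<noteq> 0" using card_dual_pos[where 'a = 'a] by simp
  have "(indicator (cylinder S u) x :: complex) = (\<Prod>k\<in>S. if x k - u k = 0 then 1 else 0)"
    using assms by (auto simp: indicator_def cylinder_def)
  also have "\<dots> = (\<Prod>k\<in>S. (\<Sum>\<psi>\<in>dual. \<psi> (x k - u k)) / ?N)"
    using N by (intro prod.cong) (auto simp: sum_dual)
  also have "\<dots> = (\<Prod>k\<in>S. \<Sum>\<psi>\<in>dual. \<psi> (x k - u k) / ?N)"
    by (simp add: sum_divide_distrib)
  also have "\<dots> = (\<Sum>c\<in>S \<rightarrow>\<^sub>E dual. \<Prod>k\<in>S. c k (x k - u k) / ?N)"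
    using assms by (intro prod_sum_PiE) (auto simp: finite_dual)
  also have "\<dots> = (\<Sum>c\<in>S \<rightarrow>\<^sub>E dual. prod_char S c (- u) / ?N ^ card S * prod_char S c x)"
  proof (intro sum.cong refl)
    fix c assume "c \<in> S \<rightarrow>\<^sub>E (dual :: ('a \<Rightarrow> complex) set)"
    then have c: "c k \<in> dual" if "k \<in> S" for k using that by auto
    have "(\<Prod>k\<in>S. c k (x k - u k) / ?N) = (\<Prod>k\<in>S. c k ((- u) k) * c k (x k) / ?N)"
    proof (intro prod.cong refl)
      fix k assume "k \<in> S"
      then have "c k (- u k + x k) = c k (- u k) * c k (x k)" using c by (simp only: dual_iff)
      then show "c k (x k - u k) / ?N = c k ((- u) k) * c k (x k) / ?N" by simp
    qed
    then show "(\<Prod>k\<in>S. c k (x k - u k) / ?N) = prod_char S c (- u) / ?N ^ card S * prod_char S c x"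
      by (simp add: prod_char_def prod.distrib prod_dividef)
  qed
  finally show ?thesis .
qed

lemma measure_cylinder_eq:
  fixes u :: "int \<Rightarrow> 'a::{finite, ab_group_add}"
  assumes M: "M \<in> borel_prob_measures" and S: "finite S"
  shows "complex_of_real (measure M (cylinder S u)) = (\<Sum>c\<in>S \<rightarrow>\<^sub>E dual.
    prod_char S c (- u) / of_nat (card (dual :: ('a \<Rightarrow> complex) set)) ^ card S
      * fourier_coeff M (prod_char S c))"
proof -
  interpret prob_space M using M by (rule borel_prob_measuresD)
  let ?a = "\<lambda>c. prod_char S c (- u) / of_nat (card (dual :: ('a \<Rightarrow> complex) set)) ^ card S"
  have "complex_of_real (measure M (cylinder S u)) = complex_of_real (\<integral>x. indicator (cylinder S u) x \<partial>M)"
    using borel_prob_measuresD(3)[OF M] by simp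
  also have "\<dots> = (\<integral>x. complex_of_real (indicator (cylinder S u) x) \<partial>M)"
    by (rule integral_complex_of_real[symmetric])
  also have "\<dots> = (\<integral>x. (\<Sum>c\<in>S \<rightarrow>\<^sub>E dual. ?a c * prod_char S c x) \<partial>M)"
    unfolding cylinder_indicator_eq[OF S, symmetric]
    by (intro Bochner_Integration.integral_cong) (auto simp: indicator_def)
  also have "\<dots> = (\<Sum>c\<in>S \<rightarrow>\<^sub>E dual. \<integral>x. ?a c * prod_char S c x \<partial>M)"
    using S by (intro Bochner_Integration.integral_sum integrable_mult_right
        integrable_character[OF M] config_character_prod_char) auto
  finally show ?thesis by (simp add: fourier_coeff_def)
qed

section \<open>Fourier coefficients of Bernoulli measures\<close>

text \<open>The integrand sees only the coordinates in \<open>S\<close>, so the infinite product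
  measure may be replaced by its finite marginal, where integrals of products factor.\<close>

lemma integral_bernoulli_prod_char:
  fixes c :: "int \<Rightarrow> 'a::finite \<Rightarrow> complex"
  assumes "finite S"
  shows "(\<integral>x. prod_char S c x \<partial>bernoulli \<beta>) = (\<Prod>k\<in>S. \<integral>a. c k a \<partial>measure_pmf \<beta>)"
proof -
  interpret P: product_prob_space "\<lambda>_::int. measure_pmf \<beta>" UNIV
    by (rule product_prob_spaceI) (rule measure_pmf.prob_space_axioms)
  let ?PS = "\<Pi>\<^sub>M _\<in>S. measure_pmf \<beta>"
  have meas: "prod_char S c \<in> borel_measurable ?PS"
    unfolding prod_char_def[abs_def]
  proof (intro borel_measurable_prod)
    fix k assume "k \<in> S"
    then show "(\<lambda>x. c k (x k)) \<in> borel_measurable ?PS"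
      using measurable_component_singleton[of k S "\<lambda>_. measure_pmf \<beta>"]
      by (rule_tac measurable_compose[of "\<lambda>x. x k" _ "measure_pmf \<beta>"]) auto
  qed
  have "(\<integral>x. prod_char S c x \<partial>bernoulli \<beta>) = (\<integral>x. prod_char S c (restrict x S) \<partial>bernoulli \<beta>)"
    by (intro Bochner_Integration.integral_cong) (auto simp: prod_char_def)
  also have "\<dots> = (\<integral>x. prod_char S c x \<partial>distr (bernoulli \<beta>) ?PS (\<lambda>x. restrict x S))"
    unfolding bernoulli_def
    by (intro integral_distr[symmetric] meas measurable_restrict_subset) simp
  also have "\<dots> = (\<integral>x. prod_char S c x \<partial>?PS)"
    unfolding bernoulli_def using P.distr_PiM_restrict_finite[OF assms] by simp
  also have "\<dots> = (\<Prod>k\<in>S. \<integral>a. c k a \<partial>measure_pmf \<beta>)"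
    unfolding prod_char_def
    by (intro P.product_integral_prod assms integrable_measure_pmf_finite) simp
  finally show ?thesis .
qed

lemma fourier_coeff_bernoulli:
  fixes \<psi> :: "'a::{finite, ab_group_add} config \<Rightarrow> complex"
  assumes "config_character \<psi>"
  shows "fourier_coeff (bernoulli \<beta>) \<psi> = (\<Prod>k\<in>char_supp \<psi>. \<integral>a. factor \<psi> k a \<partial>measure_pmf \<beta>)"
  unfolding fourier_coeff_def
  using integral_bernoulli_prod_char[OF finite_char_supp[OF assms], where c = "factor \<psi>" and \<beta> = \<beta>]
  by (simp add: prod_char_factor[OF assms, symmetric])

lemma uniform_bernoulli_in_borel_prob_measures: "uniform_bernoulli \<in> borel_prob_measures"
  unfolding uniform_bernoulli_def by (rule bernoulli_in_borel_prob_measures)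

lemma integral_pmf_of_UNIV:
  fixes f :: "'a::finite \<Rightarrow> complex"
  shows "(\<integral>a. f a \<partial>measure_pmf (pmf_of_set UNIV)) = (\<Sum>a\<in>UNIV. f a) / of_nat CARD('a)"
  by (subst integral_measure_pmf[of UNIV])
     (auto simp: scaleR_conv_of_real sum_divide_distrib)

lemma fourier_coeff_uniform_bernoulli:
  fixes \<psi> :: "'a::{finite, ab_group_add} config \<Rightarrow> complex"
  assumes "config_character \<psi>" "nontrivial \<psi>"
  shows "fourier_coeff uniform_bernoulli \<psi> = 0"
proof -
  obtain k where k: "k \<in> char_supp \<psi>" using char_supp_empty_iff[OF assms(1)] assms(2) by blast
  then have "(\<integral>a. factor \<psi> k a \<partial>measure_pmf (pmf_of_set UNIV)) = 0"
    using sum_nontrivial_dual[OF factor_in_dual[OF assms(1)], of k]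
    by (simp add: integral_pmf_of_UNIV char_supp_def)
  then show ?thesis
    unfolding uniform_bernoulli_def fourier_coeff_bernoulli[OF assms(1)]
    using k finite_char_supp[OF assms(1)] by auto
qed

section \<open>Fourier criterion for randomization\<close>

text \<open>Both expansions have coefficients independent of the measure, so limits pass through
  term by term. They also respect supports: a cylinder on \<open>S\<close> involves only characters
  supported in \<open>S\<close>, and a character is a combination of cylinders on its own support.
  This is why one statement handles every \<open>U\<close>.\<close>

lemma cylinder_convergence_iff_fourier:
  fixes M :: "nat \<Rightarrow> ('a::{finite, ab_group_add}) config measure"
  assumes M: "\<And>t. M t \<in> borel_prob_measures"
  shows "(\<forall>S u. finite S \<and> S \<subseteq> U \<longrightarrow>
      (\<lambda>t. measure (M t) (cylinder S u)) \<longlonglongrightarrow> measure uniform_bernoulli (cylinder S u)) \<longleftrightarrow>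
    (\<forall>\<psi>. config_character \<psi> \<and> nontrivial \<psi> \<and> char_supp \<psi> \<subseteq> U \<longrightarrow>
      (\<lambda>t. fourier_coeff (M t) \<psi>) \<longlonglongrightarrow> 0)"
    (is "?cyl \<longleftrightarrow> ?fourier")
proof
  assume cyl: ?cyl
  show ?fourier
  proof (intro allI impI)
    fix \<psi> :: "'a config \<Rightarrow> complex"
    assume "config_character \<psi> \<and> nontrivial \<psi> \<and> char_supp \<psi> \<subseteq> U"
    then have \<psi>: "config_character \<psi>" "nontrivial \<psi>" "char_supp \<psi> \<subseteq> U" by auto
    note int = integral_local_on[OF _ finite_char_supp[OF \<psi>(1)] local_on_character[OF \<psi>(1)]]
    have "(\<lambda>t. fourier_coeff (M t) \<psi>) \<longlonglongrightarrow> fourier_coeff uniform_bernoulli \<psi>"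
      unfolding fourier_coeff_def int[OF M] int[OF uniform_bernoulli_in_borel_prob_measures]
      using cyl finite_char_supp[OF \<psi>(1)] \<psi>(3)
      by (intro tendsto_sum tendsto_scaleR tendsto_const) auto
    then show "(\<lambda>t. fourier_coeff (M t) \<psi>) \<longlonglongrightarrow> 0"
      using fourier_coeff_uniform_bernoulli[OF \<psi>(1,2)] by simp
  qed
next
  assume fourier: ?fourier
  show ?cyl
  proof (intro allI impI)
    fix S and u :: "'a config" assume "finite S \<and> S \<subseteq> U"
    then have S: "finite S" "S \<subseteq> U" by auto
    have conv: "(\<lambda>t. fourier_coeff (M t) (prod_char S c)) \<longlonglongrightarrow> fourier_coeff uniform_bernoulli (prod_char S c)"
      if "c \<in> S \<rightarrow>\<^sub>E dual" for c
    proof -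
      have c: "\<And>k. k \<in> S \<Longrightarrow> c k \<in> dual" using that by auto
      note \<psi> = config_character_prod_char[of S c, OF S(1) c]
      show ?thesis
      proof (cases "nontrivial (prod_char S c)")
        case True
        have "char_supp (prod_char S c) \<subseteq> U" using char_supp_prod_char[of S c, OF S(1) c] S(2) by auto
        then show ?thesis
          using fourier \<psi> True fourier_coeff_uniform_bernoulli[OF \<psi> True] by simp
      next
        \<comment> \<open>The expansion of a cylinder contains the trivial character, whose
          coefficient is 1 for every probability measure.\<close>
        case False
        then show ?thesis
          using fourier_coeff_trivial[OF M \<psi> False]
            fourier_coeff_trivial[OF uniform_bernoulli_in_borel_prob_measures \<psi> False] by simp
      qed
    qed
    have "(\<lambda>t. complex_of_real (measure (M t) (cylinder S u)))
        \<longlonglongrightarrow> complex_of_real (measure uniform_bernoulli (cylinder S u))"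
      unfolding measure_cylinder_eq[OF M S(1)]
        measure_cylinder_eq[OF uniform_bernoulli_in_borel_prob_measures S(1)]
      by (intro tendsto_sum tendsto_mult tendsto_const conv)
    then show "(\<lambda>t. measure (M t) (cylinder S u)) \<longlonglongrightarrow> measure uniform_bernoulli (cylinder S u)"
      by (simp only: tendsto_of_real_iff)
  qed
qed

lemma weak_star_conv_iff_fourier:
  fixes M :: "nat \<Rightarrow> ('a::{finite, ab_group_add}) config measure"
  assumes M: "\<And>t. M t \<in> borel_prob_measures"
  shows "weak_star_conv M uniform_bernoulli \<longleftrightarrow>
    (\<forall>\<psi>. config_character \<psi> \<and> nontrivial \<psi> \<longrightarrow> (\<lambda>t. fourier_coeff (M t) \<psi>) \<longlonglongrightarrow> 0)"
  using weak_star_conv_iff_cylinders[OF M uniform_bernoulli_in_borel_prob_measures]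
    cylinder_convergence_iff_fourier[OF M, where U = UNIV]
  by simp

lemma continuous_map_funpow:
  assumes "continuous_map X X f"
  shows "continuous_map X X (f ^^ n)"
proof (induction n)
  case (Suc n)
  then show ?case using continuous_map_compose[OF Suc assms] by (simp add: o_def)
qed (simp add: id_def)

lemma config_character_comp_funpow:
  assumes F: "abelian_CA F" and \<psi>: "config_character \<psi>"
  shows "config_character (\<psi> \<circ> F ^^ t)"
proof -
  have "(F ^^ t) (x + y) = (F ^^ t) x + (F ^^ t) y" for x y
    using F by (induction t) (auto simp: abelian_CA_def)
  moreover have "continuous_map config_topology config_topology (F ^^ t)"
    using F by (intro continuous_map_funpow) (simp add: abelian_CA_def)
  ultimately show ?thesis
    using \<psi> continuous_map_compose[of config_topology config_topology "F ^^ t" euclidean \<psi>]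
    by (auto simp: character_def)
qed

lemma
  assumes "continuous_map config_topology config_topology G" "M \<in> borel_prob_measures"
  shows pushforward_in_borel_prob_measures: "pushforward G M \<in> borel_prob_measures"
    and fourier_coeff_pushforward:
      "config_character \<psi> \<Longrightarrow> fourier_coeff (pushforward G M) \<psi> = fourier_coeff M (\<psi> \<circ> G)"
proof -
  interpret prob_space M using assms(2) by (rule borel_prob_measuresD)
  have G: "G \<in> M \<rightarrow>\<^sub>M config_borel"
    using continuous_map_config_measurable[OF assms(1)] borel_prob_measuresD(2)[OF assms(2)]
    by (simp cong: measurable_cong_sets)
  then show "pushforward G M \<in> borel_prob_measures"
    by (simp add: borel_prob_measures_def prob_space_distr)
  assume "config_character \<psi>"
  then have "\<psi> \<in> borel_measurable config_borel"
    by (intro continuous_map_borel_measurable) (simp add: character_def)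
  then show "fourier_coeff (pushforward G M) \<psi> = fourier_coeff M (\<psi> \<circ> G)"
    unfolding fourier_coeff_def by (simp add: integral_distr[OF G] o_def)
qed

subsection \<open>Rank and Fourier decay\<close>

lemma cmod_expectation_dual_le:
  fixes \<psi> :: "'a::{finite, ab_group_add} \<Rightarrow> complex"
  assumes "\<psi> \<in> dual"
  shows "cmod (\<integral>a. \<psi> a \<partial>measure_pmf \<beta>) \<le> 1"
proof -
  have "cmod (\<integral>a. \<psi> a \<partial>measure_pmf \<beta>) \<le> (\<integral>a. cmod (\<psi> a) \<partial>measure_pmf \<beta>)"
    by (rule integral_norm_bound)
  also have "\<dots> = 1" using assms by (simp add: dual_iff)
  finally show ?thesis .
qed

text \<open>The equality case of the triangle inequality. After rotation by the conjugate of the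
  mean \<open>z\<close>, the mean becomes 1, while every real part is at most 1; so the real part is
  1 almost everywhere, and modulus 1 then forces the imaginary part to vanish.\<close>

lemma expectation_dual_const_on_support:
  fixes \<psi> :: "'a::{finite, ab_group_add} \<Rightarrow> complex"
  assumes \<psi>: "\<psi> \<in> dual" and 1: "cmod (\<integral>a. \<psi> a \<partial>measure_pmf \<beta>) = 1" and a: "a \<in> set_pmf \<beta>"
  shows "\<psi> a = (\<integral>a. \<psi> a \<partial>measure_pmf \<beta>)"
proof -
  define z where "z = (\<integral>a. \<psi> a \<partial>measure_pmf \<beta>)"
  have z: "cmod z = 1" using 1 by (simp add: z_def)
  have norm: "cmod (cnj z * \<psi> b) = 1" for b using z \<psi> by (simp add: norm_mult dual_iff)
  have "cnj z * z = 1" using z by (simp add: complex_norm_square[symmetric] mult.commute)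
  then have "(\<integral>b. cnj z * \<psi> b \<partial>measure_pmf \<beta>) = 1" by (simp add: z_def)
  then have "Re (\<integral>b. cnj z * \<psi> b \<partial>measure_pmf \<beta>) = 1" by simp
  then have "(\<integral>b. Re (cnj z * \<psi> b) \<partial>measure_pmf \<beta>) = 1"
    by (subst integral_Re) (auto intro: integrable_measure_pmf_finite)
  then have "(\<integral>b. 1 - Re (cnj z * \<psi> b) \<partial>measure_pmf \<beta>) = 0"
    by (subst Bochner_Integration.integral_diff) (auto intro: integrable_measure_pmf_finite)
  moreover have nonneg: "0 \<le> 1 - Re (cnj z * \<psi> b)" for b
    using complex_Re_le_cmod[of "cnj z * \<psi> b"] norm[of b] by linarith
  ultimately have "AE b in measure_pmf \<beta>. 1 - Re (cnj z * \<psi> b) = 0"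
    by (subst (asm) integral_nonneg_eq_0_iff_AE) (auto intro: integrable_measure_pmf_finite)
  then have re: "Re (cnj z * \<psi> a) = 1" using a by (simp add: AE_measure_pmf_iff)
  then have "Im (cnj z * \<psi> a) = 0" using norm[of a] by (simp add: cmod_def)
  with re have eq: "cnj z * \<psi> a = 1" by (simp add: complex_eq_iff)
  have "\<psi> a = (cnj z * z) * \<psi> a" using \<open>cnj z * z = 1\<close> by simp
  also have "\<dots> = z * (cnj z * \<psi> a)" by (simp only: mult_ac)
  finally have "\<psi> a = z" unfolding eq by simp
  then show ?thesis by (simp add: z_def)
qed

text \<open>A mean of modulus 1 would make the character constant on the support, confining the
  support to a single coset of the kernel, a proper subgroup.\<close>

lemma nondegenerate_expectation_less_1:
  fixes \<beta> :: "'a::{finite, ab_group_add} pmf"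
  assumes \<beta>: "nondegenerate \<beta>" and \<psi>: "\<psi> \<in> dual" "nontrivial \<psi>"
  shows "cmod (\<integral>a. \<psi> a \<partial>measure_pmf \<beta>) < 1"
proof (rule ccontr)
  assume "\<not> cmod (\<integral>a. \<psi> a \<partial>measure_pmf \<beta>) < 1"
  then have 1: "cmod (\<integral>a. \<psi> a \<partial>measure_pmf \<beta>) = 1"
    using cmod_expectation_dual_le[OF \<psi>(1), of \<beta>] by linarith
  let ?H = "{x. \<psi> x = 1}"
  have add: "\<psi> (x + y) = \<psi> x * \<psi> y" for x y using \<psi>(1) by (simp add: dual_iff)
  have minus: "\<psi> (- x) = inverse (\<psi> x)" for x
    using add[of x "- x"] dual_0[OF \<psi>(1)] dual_nonzero[OF \<psi>(1), of x] by (simp add: field_simps)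
  have "is_subgroup ?H" by (simp add: is_subgroup_def dual_0[OF \<psi>(1)] add minus)
  moreover have "?H \<noteq> UNIV" using \<psi>(2) by (auto simp: nontrivial_def)
  ultimately obtain C D where CD: "C \<in> cosets ?H" "D \<in> cosets ?H" "C \<noteq> D"
      "set_pmf \<beta> \<inter> C \<noteq> {}" "set_pmf \<beta> \<inter> D \<noteq> {}"
    using \<beta> unfolding nondegenerate_def by blast
  have coset: "(+) c ` ?H = {x. \<psi> x = \<psi> c}" for c
  proof safe
    fix x assume "\<psi> x = \<psi> c"
    then have "\<psi> (- c + x) = 1" using dual_nonzero[OF \<psi>(1), of c] by (simp only: add minus) simp
    moreover have "x = c + (- c + x)" by simp
    ultimately show "x \<in> (+) c ` ?H" by blast
  qed (simp add: add)
  obtain c d where cd: "C = {x. \<psi> x = \<psi> c}" "D = {x. \<psi> x = \<psi> d}"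
    using CD(1,2) coset by (auto simp: cosets_def)
  obtain a b where "a \<in> set_pmf \<beta>" "\<psi> a = \<psi> c" "b \<in> set_pmf \<beta>" "\<psi> b = \<psi> d"
    using CD(4,5) cd by blast
  then have "\<psi> c = \<psi> d"
    using expectation_dual_const_on_support[OF \<psi>(1) 1] by metis
  then show False using CD(3) cd by simp
qed

lemma nondegenerate_bernoulli_subset:
  "nondegenerate_bernoulli_measures \<subseteq> (harmonically_mixing_measures :: 'a::{finite, ab_group_add} config measure set)"
proof
  fix \<mu> :: "'a config measure" assume "\<mu> \<in> nondegenerate_bernoulli_measures"
  then obtain \<beta> :: "'a pmf" where \<mu>: "\<mu> = bernoulli \<beta>" and \<beta>: "nondegenerate \<beta>"
    by (auto simp: nondegenerate_bernoulli_measures_def)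
  \<comment> \<open>Inserting 0 keeps the set nonempty for the trivial group, which has no
    nontrivial character, and yields \<open>0 \<le> q\<close>.\<close>
  define V where "V = insert 0 ((\<lambda>\<psi>. cmod (\<integral>a. \<psi> a \<partial>measure_pmf \<beta>)) ` {\<psi> \<in> dual. nontrivial \<psi>})"
  define q where "q = Max V"
  have finV: "finite V" by (simp add: V_def finite_dual)
  have "q \<in> V" unfolding q_def using finV by (intro Max_in) (auto simp: V_def)
  then have q1: "q < 1" using nondegenerate_expectation_less_1[OF \<beta>] by (auto simp: V_def)
  have q0: "0 \<le> q" unfolding q_def using finV by (intro Max_ge) (auto simp: V_def)
  have q: "cmod (\<integral>a. \<psi> a \<partial>measure_pmf \<beta>) \<le> q" if "\<psi> \<in> dual" "nontrivial \<psi>" for \<psi>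
    unfolding q_def using finV that by (intro Max_ge) (auto simp: V_def)
  have bound: "cmod (fourier_coeff \<mu> \<psi>) \<le> q ^ char_rank \<psi>" if \<psi>: "config_character \<psi>" for \<psi>
  proof -
    have "cmod (fourier_coeff \<mu> \<psi>) = (\<Prod>k\<in>char_supp \<psi>. cmod (\<integral>a. factor \<psi> k a \<partial>measure_pmf \<beta>))"
      unfolding \<mu> fourier_coeff_bernoulli[OF \<psi>] by (rule prod_norm[symmetric])
    also have "\<dots> \<le> (\<Prod>k\<in>char_supp \<psi>. q)"
      using factor_in_dual[OF \<psi>] by (intro prod_mono) (auto simp: char_supp_def intro!: q)
    finally show ?thesis by (simp add: char_rank_def)
  qed
  have "harmonically_mixing \<mu>"
    unfolding harmonically_mixing_def
  proof (intro allI impI)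
    fix \<epsilon> :: real assume "\<epsilon> > 0"
    then obtain n where n: "q ^ n < \<epsilon>" using real_arch_pow_inv q1 by blast
    have "cmod (fourier_coeff \<mu> \<psi>) < \<epsilon>" if "config_character \<psi>" "char_rank \<psi> > Suc n" for \<psi>
    proof -
      have "cmod (fourier_coeff \<mu> \<psi>) \<le> q ^ char_rank \<psi>" using bound that(1) by blast
      also have "\<dots> \<le> q ^ n" using that(2) q0 q1 by (intro power_decreasing) auto
      finally show ?thesis using n by linarith
    qed
    \<comment> \<open>The successor supplies the positive threshold demanded by the definition even
      when \<open>n\<close> is 0.\<close>
    then show "\<exists>R>0. \<forall>\<psi>. config_character \<psi> \<and> char_rank \<psi> > R \<longrightarrow> cmod (fourier_coeff \<mu> \<psi>) < \<epsilon>"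
      by (intro exI[of _ "Suc n"]) auto
  qed
  then show "\<mu> \<in> harmonically_mixing_measures"
    using bernoulli_in_borel_prob_measures[of \<beta>] \<mu> by (simp add: harmonically_mixing_measures_def)
qed

text \<open>The uniform half of the mixture gives full support, hence nondegeneracy, and contributes
  nothing to the mean of a nontrivial character; the point mass at 0 contributes 1/2, so no mean
  vanishes.\<close>

lemma ex_nondegenerate_strongly_nonuniform:
  "\<exists>\<mu> :: 'a::{finite, ab_group_add} config measure.
     \<mu> \<in> nondegenerate_bernoulli_measures \<and> \<mu> \<in> strongly_nonuniform_bernoulli_measures"
proof -
  define \<beta> :: "'a pmf" where
    "\<beta> = bind_pmf (bernoulli_pmf (1/2)) (\<lambda>b. if b then return_pmf 0 else pmf_of_set UNIV)"
  have supp: "set_pmf \<beta> = UNIV" by (auto simp: \<beta>_def set_pmf_bernoulli)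
  have "nondegenerate \<beta>"
    unfolding nondegenerate_def
  proof (intro allI impI)
    fix H :: "'a set" assume H: "is_subgroup H \<and> H \<noteq> UNIV"
    then obtain a where a: "a \<notin> H" by blast
    have "0 \<in> H" using H by (simp add: is_subgroup_def)
    then have "a \<in> (+) a ` H" by force
    then have "H \<noteq> (+) a ` H" "(+) a ` H \<noteq> {}" using a by auto
    moreover have "H = (+) 0 ` H" by simp
    then have "H \<in> cosets H" unfolding cosets_def by blast
    moreover have "(+) a ` H \<in> cosets H" unfolding cosets_def by blast
    ultimately show "\<exists>C\<in>cosets H. \<exists>D\<in>cosets H. C \<noteq> D \<and> set_pmf \<beta> \<inter> C \<noteq> {} \<and> set_pmf \<beta> \<inter> D \<noteq> {}"
      using \<open>0 \<in> H\<close> unfolding supp by (intro bexI[of _ H] bexI[of _ "(+) a ` H"]) auto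
  qed
  moreover have nz: "(\<integral>a. \<psi> a \<partial>measure_pmf \<beta>) \<noteq> 0" if \<psi>: "\<psi> \<in> dual" for \<psi> :: "'a \<Rightarrow> complex"
  proof (cases "nontrivial \<psi>")
    case True
    have "(\<integral>a. \<psi> a \<partial>measure_pmf \<beta>)
        = (1/2) *\<^sub>R \<psi> 0 + (1/2) *\<^sub>R (\<integral>a. \<psi> a \<partial>measure_pmf (pmf_of_set UNIV))"
      unfolding \<beta>_def by (subst pmf_expectation_bind[of UNIV]) (auto simp: UNIV_bool)
    also have "\<dots> = 1/2"
      using sum_nontrivial_dual[OF \<psi> True] by (simp add: integral_pmf_of_UNIV dual_0[OF \<psi>] scaleR_conv_of_real)
    finally show ?thesis by (metis zero_neq_one divide_eq_0_iff zero_neq_numeral)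
  next
    case False
    then show ?thesis by (simp add: nontrivial_def)
  qed
  have "strongly_nonuniform (bernoulli \<beta>)"
    unfolding strongly_nonuniform_def
  proof (intro allI impI)
    fix \<psi> :: "'a config \<Rightarrow> complex" assume \<psi>: "config_character \<psi>"
    show "fourier_coeff (bernoulli \<beta>) \<psi> \<noteq> 0"
      unfolding fourier_coeff_bernoulli[OF \<psi>] prod_zero_iff[OF finite_char_supp[OF \<psi>]]
      using nz[OF factor_in_dual[OF \<psi>]] by blast
  qed
  ultimately show ?thesis
    unfolding nondegenerate_bernoulli_measures_def strongly_nonuniform_bernoulli_measures_def by blast
qed

text \<open>The hypothesis is tested on the character that reads off the single coordinate
  0.\<close>

lemma strongly_nonuniform_expectation_nonzero:
  fixes \<beta> :: "'a::{finite, ab_group_add} pmf"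
  assumes "strongly_nonuniform (bernoulli \<beta>)" "\<psi> \<in> dual"
  shows "(\<integral>a. \<psi> a \<partial>measure_pmf \<beta>) \<noteq> 0"
proof -
  have "config_character (prod_char {0} (\<lambda>_. \<psi>))"
    using assms(2) by (intro config_character_prod_char) auto
  then have "fourier_coeff (bernoulli \<beta>) (prod_char {0} (\<lambda>_. \<psi>)) \<noteq> 0"
    using assms(1) by (simp add: strongly_nonuniform_def)
  then show ?thesis by (simp add: fourier_coeff_def integral_bernoulli_prod_char)
qed

section \<open>Growth of ranks versus decay of coefficients\<close>

lemma rank_at_top_if_fourier_tendsto_0:
  fixes \<beta> :: "'a::{finite, ab_group_add} pmf"
  assumes \<beta>: "strongly_nonuniform (bernoulli \<beta>)"
    and \<psi>: "\<And>t. config_character (\<psi> t)"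
    and lim: "(\<lambda>t. fourier_coeff (bernoulli \<beta>) (\<psi> t)) \<longlonglongrightarrow> 0"
  shows "filterlim (\<lambda>t. char_rank (\<psi> t)) at_top sequentially"
proof -
  \<comment> \<open>The minimum runs over the whole dual; the trivial character keeps the set
    nonempty.\<close>
  define V where "V = (\<lambda>\<phi> :: 'a \<Rightarrow> complex. cmod (\<integral>a. \<phi> a \<partial>measure_pmf \<beta>)) ` dual"
  define m where "m = Min V"
  have V: "finite V" "V \<noteq> {}" using finite_dual one_in_dual by (auto simp: V_def)
  have "m \<in> V" unfolding m_def using V by (rule Min_in)
  then have m: "0 < m" "m \<le> 1"
    using strongly_nonuniform_expectation_nonzero[OF \<beta>] cmod_expectation_dual_le by (auto simp: V_def)
  have m_le: "m \<le> cmod (\<integral>a. \<phi> a \<partial>measure_pmf \<beta>)" if "\<phi> \<in> dual" for \<phi>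
    unfolding m_def using V(1) that by (intro Min_le) (auto simp: V_def)
  have bound: "m ^ char_rank (\<psi> t) \<le> cmod (fourier_coeff (bernoulli \<beta>) (\<psi> t))" for t
  proof -
    have "m ^ char_rank (\<psi> t) = (\<Prod>k\<in>char_supp (\<psi> t). m)" by (simp add: char_rank_def)
    also have "\<dots> \<le> (\<Prod>k\<in>char_supp (\<psi> t). cmod (\<integral>a. factor (\<psi> t) k a \<partial>measure_pmf \<beta>))"
      using m(1) m_le factor_in_dual[OF \<psi>] by (intro prod_mono) auto
    also have "\<dots> = cmod (fourier_coeff (bernoulli \<beta>) (\<psi> t))"
      unfolding fourier_coeff_bernoulli[OF \<psi>] by (rule prod_norm)
    finally show ?thesis .
  qed
  show ?thesis
    unfolding filterlim_at_top
  proof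
    fix R
    have "\<forall>\<^sub>F t in sequentially. cmod (fourier_coeff (bernoulli \<beta>) (\<psi> t)) < m ^ R"
      using tendsto_norm_zero[OF lim] m(1) by (intro order_tendstoD(2)) auto
    then show "\<forall>\<^sub>F t in sequentially. R \<le> char_rank (\<psi> t)"
    proof eventually_elim
      case (elim t)
      then have less: "m ^ char_rank (\<psi> t) < m ^ R" using bound[of t] by linarith
      show ?case
      proof (rule ccontr)
        assume "\<not> R \<le> char_rank (\<psi> t)"
        \<comment> \<open>As \<open>m\<close> is at most 1, a rank below \<open>R\<close> would keep
          the coefficient at or above \<open>m ^ R\<close>.\<close>
        then have "m ^ R \<le> m ^ char_rank (\<psi> t)" using m by (intro power_decreasing) auto
        then show False using less by linarith
      qed
    qed
  qed
qed

lemma fourier_tendsto_0_if_rank_at_top: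
  assumes \<mu>: "harmonically_mixing \<mu>"
    and \<psi>: "\<And>t. config_character (\<psi> t)"
    and lim: "filterlim (\<lambda>t. char_rank (\<psi> t)) at_top sequentially"
  shows "(\<lambda>t. fourier_coeff \<mu> (\<psi> t)) \<longlonglongrightarrow> 0"
  unfolding tendsto_iff
proof (intro allI impI)
  fix \<epsilon> :: real assume "\<epsilon> > 0"
  then obtain R where R: "\<And>\<psi>. config_character \<psi> \<Longrightarrow> char_rank \<psi> > R \<Longrightarrow> cmod (fourier_coeff \<mu> \<psi>) < \<epsilon>"
    using \<mu> unfolding harmonically_mixing_def by blast
  have "\<forall>\<^sub>F t in sequentially. Suc R \<le> char_rank (\<psi> t)"
    using lim unfolding filterlim_at_top by blast
  then show "\<forall>\<^sub>F t in sequentially. dist (fourier_coeff \<mu> (\<psi> t)) 0 < \<epsilon>"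
    by eventually_elim (use R \<psi> in \<open>auto simp: Suc_le_eq\<close>)
qed

section \<open>Assembly of the three readings\<close>

text \<open>The common skeleton, with \<open>P\<close> the diffusivity and \<open>Q\<close> the
  randomization of one reading. The items form a cycle: harmonically mixing measures include the
  nondegenerate Bernoulli ones, one of these is also strongly nonuniform, and randomizing such a
  measure returns \<open>P\<close>.\<close>

lemma four_way_equivalence:
  fixes Q :: "'a::{finite, ab_group_add} config measure \<Rightarrow> bool"
  assumes "\<And>\<mu>. \<mu> \<in> harmonically_mixing_measures \<Longrightarrow> P \<Longrightarrow> Q \<mu>"
    and "\<And>\<mu>. \<mu> \<in> strongly_nonuniform_bernoulli_measures \<Longrightarrow> Q \<mu> \<Longrightarrow> P"
  shows "(P \<longleftrightarrow> (\<forall>\<mu>\<in>harmonically_mixing_measures. Q \<mu>)) \<and>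
         (P \<longleftrightarrow> (\<forall>\<mu>\<in>nondegenerate_bernoulli_measures. Q \<mu>)) \<and>
         (P \<longleftrightarrow> (\<exists>\<mu>\<in>strongly_nonuniform_bernoulli_measures. Q \<mu>))"
  using assms nondegenerate_bernoulli_subset ex_nondegenerate_strongly_nonuniform by blast

theorem proposition4:
  fixes F :: "'a::{finite, ab_group_add} config \<Rightarrow> 'a config"
  assumes "abelian_CA F"
  shows
    "((strongly_character_diffusive F \<longleftrightarrow>
         (\<forall>\<mu>\<in>harmonically_mixing_measures. strongly_randomizes F \<mu>)) \<and>
      (strongly_character_diffusive F \<longleftrightarrow>
         (\<forall>\<mu>\<in>nondegenerate_bernoulli_measures. strongly_randomizes F \<mu>)) \<and>
      (strongly_character_diffusive F \<longleftrightarrow>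
         (\<exists>\<mu>\<in>strongly_nonuniform_bernoulli_measures. strongly_randomizes F \<mu>))) \<and>
     ((character_diffusive_in_density F \<longleftrightarrow>
         (\<forall>\<mu>\<in>harmonically_mixing_measures. randomizes_in_density F \<mu>)) \<and>
      (character_diffusive_in_density F \<longleftrightarrow>
         (\<forall>\<mu>\<in>nondegenerate_bernoulli_measures. randomizes_in_density F \<mu>)) \<and>
      (character_diffusive_in_density F \<longleftrightarrow>
         (\<exists>\<mu>\<in>strongly_nonuniform_bernoulli_measures. randomizes_in_density F \<mu>))) \<and>
     (\<forall>U.
      (character_diffusive_on U F \<longleftrightarrow>
         (\<forall>\<mu>\<in>harmonically_mixing_measures. randomizes_on_cylinders U F \<mu>)) \<and>
      (character_diffusive_on U F \<longleftrightarrow>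
         (\<forall>\<mu>\<in>nondegenerate_bernoulli_measures. randomizes_on_cylinders U F \<mu>)) \<and>
      (character_diffusive_on U F \<longleftrightarrow>
         (\<exists>\<mu>\<in>strongly_nonuniform_bernoulli_measures. randomizes_on_cylinders U F \<mu>)))"
proof -
  have cont: "continuous_map config_topology config_topology (F ^^ t)" for t
    using assms by (intro continuous_map_funpow) (simp add: abelian_CA_def)
  note push = pushforward_in_borel_prob_measures[OF cont]
  note char = config_character_comp_funpow[OF assms]
  \<comment> \<open>The time sequence \<open>s\<close> is left general: the identity serves the
    strong reading and a sequence of density 1 the other.\<close>
  have weak_star: "weak_star_conv (\<lambda>t. pushforward (F ^^ s t) \<mu>) uniform_bernoulli \<longleftrightarrow>
      (\<forall>\<psi>. config_character \<psi> \<and> nontrivial \<psi> \<longrightarrow> (\<lambda>t. fourier_coeff \<mu> (\<psi> \<circ> F ^^ s t)) \<longlonglongrightarrow> 0)"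
    if \<mu>: "\<mu> \<in> borel_prob_measures" for \<mu> and s :: "nat \<Rightarrow> nat"
    using weak_star_conv_iff_fourier[of "\<lambda>t. pushforward (F ^^ s t) \<mu>", OF push[OF \<mu>]]
      fourier_coeff_pushforward[OF cont \<mu>] by simp
  have cylinders: "randomizes_on_cylinders U F \<mu> \<longleftrightarrow>
      (\<forall>\<psi>. config_character \<psi> \<and> nontrivial \<psi> \<and> char_supp \<psi> \<subseteq> U \<longrightarrow>
        (\<lambda>t. fourier_coeff \<mu> (\<psi> \<circ> F ^^ t)) \<longlonglongrightarrow> 0)"
    if \<mu>: "\<mu> \<in> borel_prob_measures" for \<mu> and U
    unfolding randomizes_on_cylinders_def
    using cylinder_convergence_iff_fourier[of "\<lambda>t. pushforward (F ^^ t) \<mu>" U, OF push[OF \<mu>]]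
      fourier_coeff_pushforward[OF cont \<mu>] by simp
  have decay: "(\<lambda>t. fourier_coeff \<mu> (\<psi> \<circ> F ^^ s t)) \<longlonglongrightarrow> 0"
    if "\<mu> \<in> harmonically_mixing_measures" "config_character \<psi>"
      "filterlim (\<lambda>t. char_rank (\<psi> \<circ> F ^^ s t)) at_top sequentially" for \<mu> \<psi> and s :: "nat \<Rightarrow> nat"
    using that fourier_tendsto_0_if_rank_at_top[of \<mu> "\<lambda>t. \<psi> \<circ> F ^^ s t"] char
    by (simp add: harmonically_mixing_measures_def)
  have growth: "filterlim (\<lambda>t. char_rank (\<psi> \<circ> F ^^ s t)) at_top sequentially"
    if "\<mu> \<in> strongly_nonuniform_bernoulli_measures" "config_character \<psi>"
      "(\<lambda>t. fourier_coeff \<mu> (\<psi> \<circ> F ^^ s t)) \<longlonglongrightarrow> 0" for \<mu> \<psi> and s :: "nat \<Rightarrow> nat"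
    using that rank_at_top_if_fourier_tendsto_0[of _ "\<lambda>t. \<psi> \<circ> F ^^ s t"] char
    by (auto simp: strongly_nonuniform_bernoulli_measures_def)
  have prob_hm: "\<mu> \<in> borel_prob_measures" if "\<mu> \<in> harmonically_mixing_measures" for \<mu> :: "'a config measure"
    using that by (simp add: harmonically_mixing_measures_def)
  have prob_nu: "\<mu> \<in> borel_prob_measures"
    if "\<mu> \<in> strongly_nonuniform_bernoulli_measures" for \<mu> :: "'a config measure"
    using that bernoulli_in_borel_prob_measures by (auto simp: strongly_nonuniform_bernoulli_measures_def)
  have strong_decay: "strongly_randomizes F \<mu>"
    if "\<mu> \<in> harmonically_mixing_measures" "strongly_character_diffusive F" for \<mu> :: "'a config measure"
    using that decay[OF that(1), where s = "\<lambda>t. t"]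
    unfolding strongly_randomizes_def weak_star[OF prob_hm[OF that(1)], where s = "\<lambda>t. t"]
      strongly_character_diffusive_def strongly_diffuses_def by blast
  have strong_growth: "strongly_character_diffusive F"
    if "\<mu> \<in> strongly_nonuniform_bernoulli_measures" "strongly_randomizes F \<mu>" for \<mu> :: "'a config measure"
    using that(2) growth[OF that(1), where s = "\<lambda>t. t"]
    unfolding strongly_randomizes_def weak_star[OF prob_nu[OF that(1)], where s = "\<lambda>t. t"]
      strongly_character_diffusive_def strongly_diffuses_def by blast
  have cylinder_decay: "randomizes_on_cylinders U F \<mu>"
    if "\<mu> \<in> harmonically_mixing_measures" "character_diffusive_on U F" for \<mu> :: "'a config measure" and U
    using that(2) decay[OF that(1), where s = "\<lambda>t. t"]
    unfolding cylinders[OF prob_hm[OF that(1)]] character_diffusive_on_def strongly_diffuses_def by blast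
  have cylinder_growth: "character_diffusive_on U F"
    if "\<mu> \<in> strongly_nonuniform_bernoulli_measures" "randomizes_on_cylinders U F \<mu>"
    for \<mu> :: "'a config measure" and U
    using that(2) growth[OF that(1), where s = "\<lambda>t. t"]
    unfolding cylinders[OF prob_nu[OF that(1)]] character_diffusive_on_def strongly_diffuses_def by blast
  have density_decay: "randomizes_in_density F \<mu>"
    if \<mu>: "\<mu> \<in> harmonically_mixing_measures" and F: "character_diffusive_in_density F"
    for \<mu> :: "'a config measure"
  proof -
    \<comment> \<open>Weak convergence needs one sequence for all nontrivial characters;
      countability of this index set lets their individual sequences be replaced by a common
      one.\<close>
    let ?I = "{\<psi> :: 'a config \<Rightarrow> complex. config_character \<psi> \<and> nontrivial \<psi>}"
    have "countable ?I" by (rule countable_subset[OF _ countable_characters]) blast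
    moreover have "\<exists>\<phi>. strict_mono \<phi> \<and> lower_density (range \<phi>) = 1 \<and>
        filterlim (\<lambda>t. char_rank (\<psi> \<circ> F ^^ \<phi> t)) at_top sequentially" if "\<psi> \<in> ?I" for \<psi>
      using F that unfolding character_diffusive_in_density_def diffuses_in_density_def by blast
    ultimately obtain \<phi> where \<phi>: "strict_mono \<phi>" "lower_density (range \<phi>) = 1"
        "\<And>\<psi>. \<psi> \<in> ?I \<Longrightarrow> filterlim (\<lambda>t. char_rank (\<psi> \<circ> F ^^ \<phi> t)) at_top sequentially"
      using common_density_sequence[of ?I "\<lambda>\<psi> t. char_rank (\<psi> \<circ> F ^^ t)"] by blast
    then have "weak_star_conv (\<lambda>t. pushforward (F ^^ \<phi> t) \<mu>) uniform_bernoulli"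
      unfolding weak_star[OF prob_hm[OF \<mu>]] using decay[OF \<mu>] by blast
    then show ?thesis using \<phi>(1,2) unfolding randomizes_in_density_def by blast
  qed
  have density_growth: "character_diffusive_in_density F"
    if \<mu>: "\<mu> \<in> strongly_nonuniform_bernoulli_measures" and "randomizes_in_density F \<mu>"
    for \<mu> :: "'a config measure"
  proof -
    \<comment> \<open>The sequence that randomizes \<open>\<mu>\<close> is itself the witness for
      every character.\<close>
    obtain \<phi> where \<phi>: "strict_mono \<phi>" "lower_density (range \<phi>) = 1"
      "weak_star_conv (\<lambda>t. pushforward (F ^^ \<phi> t) \<mu>) uniform_bernoulli"
      using \<open>randomizes_in_density F \<mu>\<close> unfolding randomizes_in_density_def by blast
    have "diffuses_in_density F \<psi>" if "config_character \<psi>" "nontrivial \<psi>" for \<psi>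
      unfolding diffuses_in_density_def
      using \<phi>(1,2) growth[OF \<mu> that(1), of \<phi>] \<phi>(3)[unfolded weak_star[OF prob_nu[OF \<mu>]]] that by blast
    then show ?thesis by (simp add: character_diffusive_in_density_def)
  qed
  show ?thesis
    by (rule conjI[OF four_way_equivalence[OF strong_decay strong_growth]
          conjI[OF four_way_equivalence[OF density_decay density_growth]
            allI[OF four_way_equivalence[OF cylinder_decay cylinder_growth]]]])
qed

end
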